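(* Let $n\ge 3$, let $b\in\mathbb{R}$, let $(f,\Gamma)$ be as in the context, and suppose there exists a constant $c_*$ such that $f(c_*,\dots,c_* )=1$. Let $\gamma_0$ (with $0\le\gamma_0<c_*$), $g$, $W(\cdot,\alpha)$, $\mu$ and $\Phi$ be as in the context, and put $$c_0=\mu(\gamma_0)+b-\frac{c_*}{2}.$$ Let $c\in\mathbb{R}$. Then there exists a unique function $u\in\Phi$ satisfying $$f(\lambda(D^2u))=1\ \text{ in } \mathbb{R}^n\setminus\overline{B_1},\qquad u=b\ \text{ on } \partial B_1,$$ and $$u(x)=\frac{c_*}{2}|x|^2+c+O(|x|^{2-n})\quad\text{as } |x|\to\infty,$$ if and only if $c\in[c_0,+\infty)$.
   Context: $B_1=\{x\in\mathbb{R}^n:|x|<1\}$, and $\lambda(D^2u)=(\lambda_1,\dots,\lambda_n)$ denotes the eigenvalues of the Hessian matrix $D^2u$. Assumptions on $(f,\Gamma)$: $\Gamma\subset\mathbb{R}^n$ is an open convex cone with vertex at the origin, symmetric (invariant under permutations of coordinates), with $$\{\lambda\in\mathbb{R}^n:\lambda_j>0,\ 1\le j\le n\}\subset\Gamma\subset\Big\{\lambda\in\mathbb{R}^n:\sum_{j=1}^n\lambda_j>0\Big\}.$$ The function $f\in C^\infty(\Gamma)\cap C^0(\overline{\Gamma})$ is concave and symmetric in $\lambda_1,\dots,\lambda_n$, with $f>0$ in $\Gamma$, $f=0$ on $\partial\Gamma$, and $f_{\lambda_j}=\partial f/\partial\lambda_j>0$ in $\Gamma$ for all $1\le j\le n$.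 A $C^2$ function $u$ on a domain $\Omega$ is admissible if $\lambda(D^2u(x))\in\Gamma$ for every $x\in\Omega$. The class $\Phi$ is the set of all radially symmetric functions $u\in C^1(\mathbb{R}^n\setminus B_1)\cap C^2(\mathbb{R}^n\setminus\overline{B_1})$ that are admissible in $\mathbb{R}^n\setminus\overline{B_1}$. The constant $\gamma_0$ and the function $g$: $\gamma_0$ is the constant with $0\le\gamma_0<c_*$ such that the set of $\gamma\in\mathbb{R}$ for which there is $\beta\in\mathbb{R}$ with $(\beta,\gamma,\dots,\gamma)\in\Gamma$ and $f(\beta,\gamma,\dots,\gamma)=1$ is exactly the interval $(\gamma_0,+\infty)$. For $\gamma\in(\gamma_0,+\infty)$, $g(\gamma)$ denotes the unique such $\beta$. One has $g(c_* )=c_*$ and $\lim_{\gamma\to\gamma_0^+}g(\gamma)=+\infty$. The function $W$: for $\alpha\ge\gamma_0$, $W(\cdot,\alpha)$ is the function, continuous on $[1,\infty)$ and $C^1$ on $(1,\infty)$ with $W(r,\alpha)>\gamma_0$ for $r>1$, that solves $$\frac{dW}{dr}=\frac{g(W)-W}{r}\ \ (r>1),\qquad W(1)=\alpha.$$ The function $\mu$: for $\alpha\ge\gamma_0$, $$\mu(\alpha)=\int_1^{+\infty}s\,\big(W(s,\alpha)-c_*\big)\,ds.$$ *)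

theory Defs
  imports "HOL-Analysis.Analysis" "HOL-Library.Landau_Symbols" "HOL-Library.FuncSet"
begin

definition partial :: "'n::finite \<Rightarrow> (real^'n \<Rightarrow> real) \<Rightarrow> real^'n \<Rightarrow> real" where
  "partial i u x = frechet_derivative u (at x) (axis i 1)"

definition hessian :: "(real^'n::finite \<Rightarrow> real) \<Rightarrow> real^'n \<Rightarrow> real^'n^'n" where
  "hessian u x = (\<chi> i j. partial i (partial j u) x)"

text \<open>Meaningful for open \<open>S\<close> only, since the derivatives are taken \<open>at x\<close> and not within \<open>S\<close>.\<close>

primrec Ck_on :: "nat \<Rightarrow> (real^'n::finite \<Rightarrow> real) \<Rightarrow> (real^'n) set \<Rightarrow> bool" where
  "Ck_on 0 u S \<longleftrightarrow> continuous_on S u"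
| "Ck_on (Suc k) u S \<longleftrightarrow>
     (\<forall>x\<in>S. u differentiable (at x)) \<and> (\<forall>i. Ck_on k (partial i u) S)"

definition smooth_on :: "(real^'n::finite \<Rightarrow> real) \<Rightarrow> (real^'n) set \<Rightarrow> bool" where
  "smooth_on u S \<longleftrightarrow> (\<forall>k. Ck_on k u S)"

text \<open>\<open>C\<^sup>1\<close> up to the boundary, for sets that need not be open: the derivatives are relative
  to \<open>S\<close>, hence one-sided at boundary points.\<close>

definition C1_up_to_boundary :: "(real^'n::finite \<Rightarrow> real) \<Rightarrow> (real^'n) set \<Rightarrow> bool" where
  "C1_up_to_boundary u S \<longleftrightarrow>
     (\<exists>Du :: real^'n \<Rightarrow> real^'n. continuous_on S Du \<and>
        (\<forall>x\<in>S. (u has_derivative (\<lambda>h. Du x \<bullet> h)) (at x within S)))"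

text \<open>The eigenvalues with multiplicity (the roots of the characteristic polynomial), listed in an
  unspecified order. They are only ever used with symmetric sets and symmetric functions, so the
  order does not matter. For a matrix with non-real eigenvalues the value is unspecified; a Hessian
  of a \<open>C\<^sup>2\<close> function is symmetric.\<close>

definition eigvals :: "real^'n^'n \<Rightarrow> real^'n::finite" where
  "eigvals A = (SOME l. \<forall>t. det (mat t - A) = (\<Prod>i\<in>UNIV. t - l $ i))"

definition admissible_on :: "(real^'n) set \<Rightarrow> (real^'n::finite \<Rightarrow> real) \<Rightarrow> (real^'n) set \<Rightarrow> bool" where
  "admissible_on \<Gamma> u S \<longleftrightarrow> (\<forall>x\<in>S. eigvals (hessian u x) \<in> \<Gamma>)"

text \<open>A function on the closed exterior \<open>- ball 0 1\<close> is represented by a total function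
  that is \<^const>\<open>extensional\<close> there, so that equality of functions is equality on the
  exterior.\<close>

definition \<Phi> :: "(real^'n::finite) set \<Rightarrow> (real^'n \<Rightarrow> real) set" where
  "\<Phi> \<Gamma> = {u \<in> extensional (- ball 0 1).
     (\<forall>x y. norm x \<ge> 1 \<and> norm x = norm y \<longrightarrow> u x = u y) \<and>
     C1_up_to_boundary u (- ball 0 1) \<and>
     Ck_on 2 u (- cball 0 1) \<and>
     admissible_on \<Gamma> u (- cball 0 1)}"

text \<open>The vector \<open>(\<beta>, \<gamma>, \<dots>, \<gamma>)\<close>, where the index \<open>k\<close> plays the role of the first coordinate.\<close>

definition bvec :: "'n::finite \<Rightarrow> real \<Rightarrow> real \<Rightarrow> real^'n" where
  "bvec k \<beta> \<gamma> = (\<chi> i. if i = k then \<beta> else \<gamma>)"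

definition g :: "'n::finite \<Rightarrow> (real^'n \<Rightarrow> real) \<Rightarrow> (real^'n) set \<Rightarrow> real \<Rightarrow> real" where
  "g k f \<Gamma> \<gamma> = (THE \<beta>. bvec k \<beta> \<gamma> \<in> \<Gamma> \<and> f (bvec k \<beta> \<gamma>) = 1)"

definition W_solution :: "(real \<Rightarrow> real) \<Rightarrow> real \<Rightarrow> real \<Rightarrow> (real \<Rightarrow> real) \<Rightarrow> bool" where
  "W_solution G \<gamma>\<^sub>0 \<alpha> w \<longleftrightarrow>
     continuous_on {1..} w \<and> w C1_differentiable_on {1<..} \<and>
     (\<forall>r>1. w r > \<gamma>\<^sub>0) \<and>
     (\<forall>r>1. (w has_real_derivative (G (w r) - w r) / r) (at r)) \<and>
     w 1 = \<alpha>"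

definition W :: "(real \<Rightarrow> real) \<Rightarrow> real \<Rightarrow> real \<Rightarrow> real \<Rightarrow> real" where
  "W G \<gamma>\<^sub>0 r \<alpha> = (THE w. w \<in> extensional {1..} \<and> W_solution G \<gamma>\<^sub>0 \<alpha> w) r"

definition \<mu> :: "(real \<Rightarrow> real) \<Rightarrow> real \<Rightarrow> real \<Rightarrow> real \<Rightarrow> real" where
  "\<mu> G \<gamma>\<^sub>0 c\<^sub>s \<alpha> = integral {1..} (\<lambda>s. s * (W G \<gamma>\<^sub>0 s \<alpha> - c\<^sub>s))"

end

(*  A radial function u(x) = phi(|x|) with w(r) = phi'(r)/r has a Hessian with eigenvalues w + r w'
    (once) and w (n - 1 times), so the equation becomes the autonomous (in log r) scalar equation
    r w' = g(w) - w with the decreasing right-hand side g(w) - w. Concavity of f makes g convex with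
    slope 1 - n at the fixed point c_s; hence the flow is contracting and w - c_s = O(r^(-n)).
    Solutions u with u = b on the sphere thus correspond to the initial values
    alpha = w(1) >= gamma_0, the constant in the expansion of u is mu(alpha) + b - c_s/2, and mu is a
    continuous, strictly increasing, unbounded function on [gamma_0, oo).  *)

theory Submission
  imports Defs
begin

text \<open>At the threshold \<open>\<gamma>\<^sub>0\<close> the function \<open>g\<close> blows up,
  so the equation is singular at \<open>r = 1\<close> and Picard-Lindelof does not apply. Existence
  is obtained by separation of variables in log r; uniqueness, order and continuity in the initial
  value follow from monotonicity of the right-hand side, tested only for \<open>r > 1\<close>. The
  closed condition alpha >= gamma_0 is what remains, at the sphere, of w > gamma_0 outside it. The
  slope 1 - n is forced by symmetry: all partial derivatives of f agree at the diagonal point (c_s,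
  ..., c_s). Convexity gives only one half of the linearization: below c_s the decay is at least
  r^(-n), above c_s it is at most r^(-n). The latter makes mu unbounded. The missing upper bound
  above c_s needs a quadratic remainder, taken from the differentiability of the partial derivatives
  of f at the diagonal point. Together with the crude rate 1/r its contribution is integrable in log
  r, so it costs only a constant factor.\<close>

section \<open>Eigenvalues of radial Hessians\<close>

lemma prod_monic_linear_unique:
  fixes l m :: "real^'n::finite"
  assumes "\<And>t. (\<Prod>i\<in>UNIV. t - l $ i) = (\<Prod>i\<in>UNIV. t - m $ i)"
  obtains p where "p permutes UNIV" and "l = (\<chi> i. m $ p i)"
proof -
  have proots: "proots (\<Prod>i\<in>UNIV. [:- v $ i, 1:]) = image_mset (($) v) (mset_set UNIV)"
    for v :: "real^'n"
    by (subst proots_prod) (auto simp: sum_unfold_sum_mset)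
  have "poly (\<Prod>i\<in>UNIV. [:- l $ i, 1:]) = poly (\<Prod>i\<in>UNIV. [:- m $ i, 1:])"
    using assms by (simp add: fun_eq_iff poly_prod)
  then have "image_mset (($) l) (mset_set UNIV) = image_mset (($) m) (mset_set UNIV)"
    unfolding poly_eq_poly_eq_iff by (metis proots)
  then obtain p where "p permutes UNIV" "\<forall>i\<in>UNIV. l $ i = m $ p i"
    using image_mset_eq_implies_permutes[OF finite_class.finite_UNIV] by metis
  then show thesis
    using that by (simp add: vec_eq_iff)
qed

text \<open>\<open>eigvals\<close> picks an unspecified ordering, so the spectrum can be known only
  up to a permutation; symmetry of \<Gamma> and f absorbs it later.\<close>

lemma eigvals_eq_permuted:
  fixes A :: "real^'n^'n::finite"
  assumes "\<And>t. det (mat t - A) = (\<Prod>i\<in>UNIV. t - m $ i)"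
  obtains p where "p permutes UNIV" and "eigvals A = (\<chi> i. m $ p i)"
proof -
  have "\<forall>t. det (mat t - A) = (\<Prod>i\<in>UNIV. t - eigvals A $ i)"
    unfolding eigvals_def by (rule someI[where x = m]) (use assms in blast)
  then show thesis
    using assms prod_monic_linear_unique[of "eigvals A" m] that by metis
qed

text \<open>The matrix is \<open>a\<close> times the outer square of \<open>x\<close> plus
  \<open>w\<close> times the identity. An orthogonal matrix whose column \<open>k\<close> is
  \<open>x / norm x\<close> diagonalizes it, and the eigenvalue in the direction of \<open>x\<close>
  lands in slot \<open>k\<close>.\<close>

lemma det_rank_one_update:
  fixes x :: "real^'n::finite" and k :: 'n
  assumes "x \<noteq> 0"
  shows "det (mat t - (\<chi> i j. a * (x $ i * x $ j) + (if i = j then w else 0)))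
           = (\<Prod>i\<in>UNIV. t - bvec k (w + a * (norm x)\<^sup>2) w $ i)"
proof -
  define v where "v = x /\<^sub>R norm x"
  have "norm v = 1"
    using assms by (simp add: v_def)
  then obtain Q :: "real^'n^'n" where Q: "orthogonal_matrix Q" "Q *v axis k 1 = v"
    using orthogonal_matrix_exists_basis by blast
  have Qv: "Q $ i $ k = v $ i" for i
    using Q(2) by (simp add: matrix_vector_mult_basis column_def vec_eq_iff)
  have xv: "x $ i = norm x * v $ i" for i
    using assms by (simp add: v_def)
  define D :: "real^'n^'n"
    where "D = (\<chi> i j. if i = j then t - bvec k (w + a * (norm x)\<^sup>2) w $ i else 0)"
  have QQ: "Q ** transpose Q = mat 1"
    using Q(1) by (simp add: orthogonal_matrix_def)
  have QQ': "(\<Sum>l\<in>UNIV. Q $ i $ l * Q $ j $ l) = (if i = j then 1 else 0)" for i j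
    using arg_cong[OF QQ, of "\<lambda>M. M $ i $ j"]
    by (simp add: matrix_matrix_mult_def transpose_def mat_def)
  have "(Q ** D ** transpose Q) $ i $ j
      = (mat t - (\<chi> i j. a * (x $ i * x $ j) + (if i = j then w else 0))) $ i $ j" for i j
  proof -
    have "(Q ** D ** transpose Q) $ i $ j
        = (\<Sum>l\<in>UNIV. Q $ i $ l * Q $ j $ l * (t - bvec k (w + a * (norm x)\<^sup>2) w $ l))"
      by (simp add: matrix_matrix_mult_def transpose_def D_def mult_ac if_distrib[of "(*) _"]
          cong: if_cong)
    \<comment> \<open>The diagonal is the constant \<open>t - w\<close> corrected in slot
      \<open>k\<close> only, so orthogonality of the rows handles the constant part and column
      \<open>k\<close>, which is \<open>v\<close>, the correction.\<close>
    also have "\<dots> = (\<Sum>l\<in>UNIV. (t - w) * (Q $ i $ l * Q $ j $ l)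
                     - (if l = k then a * (norm x)\<^sup>2 * (Q $ i $ l * Q $ j $ l) else 0))"
      by (intro sum.cong) (auto simp: bvec_def algebra_simps)
    also have "\<dots> = (t - w) * (if i = j then 1 else 0) - a * (norm x)\<^sup>2 * (v $ i * v $ j)"
      by (simp add: sum_subtractf sum_distrib_left[symmetric] QQ' Qv)
    finally show ?thesis
      using xv[of i] xv[of j] by (simp add: mat_def power2_eq_square mult_ac)
  qed
  then have "mat t - (\<chi> i j. a * (x $ i * x $ j) + (if i = j then w else 0)) = Q ** D ** transpose Q"
    by (simp add: vec_eq_iff)
  moreover have "det Q * det (transpose Q) = 1"
    using QQ det_mul[of Q "transpose Q"] by simp
  moreover have "det D = (\<Prod>i\<in>UNIV. t - bvec k (w + a * (norm x)\<^sup>2) w $ i)"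
    by (subst det_diagonal) (auto simp: D_def)
  moreover have "det (Q ** D ** transpose Q) = (det Q * det (transpose Q)) * det D"
    by (simp only: det_mul mult_ac)
  ultimately show ?thesis
    by simp
qed

lemma partial_eqI:
  "(u has_derivative D) (at x) \<Longrightarrow> partial i u x = D (axis i 1)"
  unfolding partial_def using frechet_derivative_at by metis

lemma open_exterior: "open (- cball 0 1 :: 'a::real_normed_vector set)"
  by (rule open_Compl) simp

context
  fixes u :: "real^'n::finite \<Rightarrow> real" and \<phi> w w' :: "real \<Rightarrow> real"
  assumes u: "\<And>x. norm x > 1 \<Longrightarrow> u x = \<phi> (norm x)"
    and \<phi>: "\<And>r. r > 1 \<Longrightarrow> (\<phi> has_real_derivative r * w r) (at r)"
    and w: "\<And>r. r > 1 \<Longrightarrow> (w has_real_derivative w' r) (at r)"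
begin

text \<open>Writing the radial derivative as \<open>r * w r\<close> makes the gradient
  \<open>w (norm x)\<close> times \<open>x\<close>, with no division by the norm; this is why
  \<open>w\<close> is carried instead of the derivative of \<open>\<phi>\<close>.\<close>

lemma radial_has_derivative:
  assumes "norm x > 1"
  shows "(u has_derivative (\<lambda>h. w (norm x) * (x \<bullet> h))) (at x)"
proof -
  have x: "x \<noteq> 0"
    using assms by auto
  have "((\<lambda>y. \<phi> (norm y)) has_derivative (\<lambda>h. (h \<bullet> sgn x) * (norm x * w (norm x)))) (at x)"
    using DERIV_compose_FDERIV[where g = norm, OF \<phi>[OF assms] has_derivative_norm[OF x]] .
  then have "(u has_derivative (\<lambda>h. (h \<bullet> sgn x) * (norm x * w (norm x)))) (at x)"
    by (rule has_derivative_transform_within_open[OF _ open_exterior])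
      (use assms in \<open>auto simp: u\<close>)
  moreover have "(\<lambda>h. (h \<bullet> sgn x) * (norm x * w (norm x))) = (\<lambda>h. w (norm x) * (x \<bullet> h))"
    using x by (auto simp: sgn_div_norm inner_commute)
  ultimately show ?thesis
    by simp
qed

lemma radial_partial: "norm x > 1 \<Longrightarrow> partial j u x = w (norm x) * x $ j"
  using partial_eqI[OF radial_has_derivative, of x j] by (simp add: inner_axis)

lemma radial_partial_has_derivative:
  assumes "norm x > 1"
  shows "(partial j u has_derivative
    (\<lambda>h. (w' (norm x) / norm x) * (x \<bullet> h) * x $ j + w (norm x) * h $ j)) (at x)"
proof -
  have x: "x \<noteq> 0"
    using assms by auto
  have w_norm: "((\<lambda>y. w (norm y)) has_derivative (\<lambda>h. (h \<bullet> sgn x) * w' (norm x))) (at x)"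
    using DERIV_compose_FDERIV[where g = norm, OF w[OF assms] has_derivative_norm[OF x]] .
  have nth: "((\<lambda>y. y $ j) has_derivative (\<lambda>h. h $ j)) (at x)"
    by (rule bounded_linear_imp_has_derivative[OF bounded_linear_vec_nth])
  have "((\<lambda>y. w (norm y) * y $ j) has_derivative
      (\<lambda>h. w (norm x) * h $ j + (h \<bullet> sgn x) * w' (norm x) * x $ j)) (at x)"
    by (rule has_derivative_mult[OF w_norm nth])
  then have "(partial j u has_derivative
      (\<lambda>h. w (norm x) * h $ j + (h \<bullet> sgn x) * w' (norm x) * x $ j)) (at x)"
    by (rule has_derivative_transform_within_open[OF _ open_exterior])
      (use assms in \<open>simp_all add: radial_partial\<close>)
  moreover have "(\<lambda>h. w (norm x) * h $ j + (h \<bullet> sgn x) * w' (norm x) * x $ j)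
      = (\<lambda>h. (w' (norm x) / norm x) * (x \<bullet> h) * x $ j + w (norm x) * h $ j)"
    by (rule ext) (simp add: sgn_div_norm inner_commute[of _ x] divide_inverse mult_ac)
  ultimately show ?thesis
    by simp
qed

lemma radial_partial2:
  assumes "norm x > 1"
  shows "partial i (partial j u) x
    = (w' (norm x) / norm x) * (x $ i * x $ j) + (if i = j then w (norm x) else 0)"
proof -
  have "axis i (1::real) $ j = (if i = j then 1 else 0)"
    by (simp add: axis_def)
  then show ?thesis
    using partial_eqI[OF radial_partial_has_derivative[OF assms], of i j]
    by (simp add: inner_axis)
qed

text \<open>The Hessian is a rank-one update with coefficient \<open>w' / norm x\<close>, which the
  factor \<open>(norm x)\<^sup>2\<close> turns into \<open>norm x * w'\<close>.\<close>

lemma radial_eigvals: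
  assumes "norm x > 1"
  obtains p where "p permutes UNIV"
    and "eigvals (hessian u x) = (\<chi> i. bvec k (w (norm x) + norm x * w' (norm x)) (w (norm x)) $ p i)"
proof -
  have x: "x \<noteq> 0"
    using assms by auto
  have H: "hessian u x
      = (\<chi> i j. (w' (norm x) / norm x) * (x $ i * x $ j) + (if i = j then w (norm x) else 0))"
    by (simp add: hessian_def radial_partial2[OF assms])
  have "w' (norm x) / norm x * (norm x)\<^sup>2 = norm x * w' (norm x)"
    using x by (simp add: power2_eq_square)
  then have "det (mat t - hessian u x)
      = (\<Prod>i\<in>UNIV. t - bvec k (w (norm x) + norm x * w' (norm x)) (w (norm x)) $ i)" for t
    unfolding H by (simp only: det_rank_one_update[OF x, of t _ _ k])
  then show thesis
    using eigvals_eq_permuted that by metis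
qed

lemma radial_Ck_on_2:
  assumes w'_cont: "continuous_on {1<..} w'"
  shows "Ck_on 2 u (- cball 0 1)"
proof -
  have w_cont: "continuous_on {1<..} w"
    using w by (meson DERIV_continuous_on DERIV_subset greaterThan_iff subset_UNIV)
  have norm_cont: "continuous_on (- cball 0 1) (\<lambda>x::real^'n. h (norm x))"
    if "continuous_on {1<..} h" for h :: "real \<Rightarrow> real"
    by (rule continuous_on_compose2[OF that]) (auto intro: continuous_intros)
  have "continuous_on (- cball 0 1) (partial i (partial j u))" for i j
  proof -
    have "continuous_on (- cball 0 1)
        (\<lambda>x. (w' (norm x) / norm x) * (x $ i * x $ j) + (if i = j then w (norm x) else 0))"
      by (cases "i = j")
        (auto intro!: continuous_intros norm_cont[OF w'_cont] norm_cont[OF w_cont])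
    then show ?thesis
      by (rule continuous_on_eq) (simp add: radial_partial2)
  qed
  moreover have "u differentiable (at x)" "partial j u differentiable (at x)"
    if "norm x > 1" for x j
    using radial_has_derivative[OF that] radial_partial_has_derivative[OF that]
      differentiableI by blast+
  ultimately show ?thesis
    by (simp add: numeral_2_eq_2)
qed

end

section \<open>The radial equation\<close>

text \<open>Nothing bounds \<open>h\<close> near \<open>a\<close>, so the travel time
  \<open>T v\<close>, the integral of \<open>1 / h\<close> from \<open>a\<close> to
  \<open>v\<close>, is inverted. Since \<open>h\<close> is antitone, \<open>1 / h\<close> is
  monotone and integrable down to \<open>a\<close>; the bound \<open>lip\<close> makes
  \<open>T\<close> diverge logarithmically at \<open>c\<close>, so the inverse is defined for all
  times and never reaches \<open>c\<close>.\<close>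

lemma autonomous_ode_exists:
  fixes h :: "real \<Rightarrow> real"
  assumes "a < m" "m < c"
    and cont: "continuous_on {a<..<c} h"
    and anti: "\<And>x y. a < x \<Longrightarrow> x \<le> y \<Longrightarrow> y < c \<Longrightarrow> h y \<le> h x"
    and pos: "\<And>x. a < x \<Longrightarrow> x < c \<Longrightarrow> 0 < h x"
    and lip: "\<And>x. m \<le> x \<Longrightarrow> x < c \<Longrightarrow> h x \<le> L * (c - x)"
  obtains w where "continuous_on {0..} w" "w 0 = a"
    "\<And>t. t > 0 \<Longrightarrow> a < w t \<and> w t < c"
    "\<And>t. t > 0 \<Longrightarrow> (w has_real_derivative h (w t)) (at t)"
proof -
  have "a < c"
    using assms by simp
  have "0 < L * (c - m)"
    using pos[of m] lip[of m] assms(1,2) by fastforce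
  then have "L > 0"
    using \<open>m < c\<close> by (simp add: zero_less_mult_iff)
  \<comment> \<open>\<open>h\<close> is unspecified at \<open>a\<close>; the value 0 there lies
    below every \<open>1 / h v\<close> and keeps \<open>q\<close> monotone on the closed
    interval.\<close>
  define q where "q v = (if v \<le> a then 0 else 1 / h v)" for v
  have "mono_on {a..v} q" if "v < c" for v
    using that by (intro mono_onI) (auto simp: q_def intro!: frac_le anti pos less_imp_le[OF pos])
  then have q_int: "q integrable_on {a..v}" if "v < c" for v
    using that integrable_on_mono_on by blast
  define T where "T v = integral {a..v} q" for v
  have T_cont: "continuous_on {a..v} T" if "v < c" for v
    unfolding T_def by (rule indefinite_integral_continuous_1[OF q_int[OF that]])
  have T_deriv: "(T has_real_derivative 1 / h v) (at v)" if v: "a < v" "v < c" for v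
  proof -
    define b where "b = (v + c) / 2"
    have b: "v < b" "b < c"
      using v by (auto simp: b_def)
    have "continuous_on {a<..<c} (\<lambda>v. 1 / h v)"
      using cont pos by (intro continuous_intros) force+
    then have "continuous_on {a<..<c} q"
      by (rule continuous_on_eq) (simp add: q_def)
    then have "continuous (at v) q"
      using v by (simp add: continuous_on_eq_continuous_at)
    then have "continuous (at v within {a..b}) q"
      by (rule continuous_at_imp_continuous_at_within)
    then have "(T has_vector_derivative q v) (at v within {a..b})"
      unfolding T_def using integral_has_vector_derivative_continuous_at[of q a b v "{}"] v b q_int
      by simp
    moreover have "at v within {a..b} = at v"
      using v b by (intro at_within_interior) simp
    ultimately show ?thesis
      using v by (simp add: has_real_derivative_iff_has_vector_derivative q_def)
  qed
  have T_less: "T x < T y" if "a \<le> x" "x < y" "y < c" for x y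
  proof (rule DERIV_pos_imp_increasing_open[OF \<open>x < y\<close>])
    show "continuous_on {x..y} T"
      using T_cont[of y] that by (auto intro: continuous_on_subset)
    show "\<exists>d. (T has_real_derivative d) (at z) \<and> 0 < d" if "x < z" "z < y" for z
      using T_deriv[of z] pos[of z] that \<open>a \<le> x\<close> \<open>y < c\<close> by (intro exI[of _ "1 / h z"]) auto
  qed
  have T_a: "T a = 0"
    by (simp add: T_def)
  \<comment> \<open>Integrated form of \<open>1 / h x \<ge> 1 / (L * (c - x))\<close> over
    \<open>{m..v}\<close>.\<close>
  have T_log: "T m + ln ((c - m) / (c - v)) / L \<le> T v" if "m \<le> v" "v < c" for v
  proof -
    have "T m + ln (c - m) / L \<le> T v + ln (c - v) / L"
    proof (rule DERIV_nonneg_imp_nondecreasing[OF \<open>m \<le> v\<close>])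
      fix x assume x: "m \<le> x" "x \<le> v"
      have "((\<lambda>x. T x + ln (c - x) / L) has_real_derivative 1 / h x + (- 1 / (c - x)) / L) (at x)"
        using x that \<open>a < m\<close> \<open>L > 0\<close> by (auto intro!: derivative_eq_intros T_deriv)
      moreover have "1 / (L * (c - x)) \<le> 1 / h x"
        using x that \<open>a < m\<close> pos[of x] lip[of x] \<open>L > 0\<close> by (intro frac_le) auto
      then have "0 \<le> 1 / h x + (- 1 / (c - x)) / L"
        by (simp add: mult.commute)
      ultimately show "\<exists>y. ((\<lambda>x. T x + ln (c - x) / L) has_real_derivative y) (at x) \<and> 0 \<le> y"
        by blast
    qed
    then show ?thesis
      using that \<open>m < c\<close> ln_div[of "c - m" "c - v"] diff_divide_distrib[of "ln (c - m)" "ln (c - v)" L]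
      by simp
  qed
  have "\<exists>v. a \<le> v \<and> v < c \<and> T v = t" if "t \<ge> 0" for t
  proof -
    \<comment> \<open>Chosen so that the logarithmic lower bound for \<open>T v\<close> contributes
      exactly \<open>t\<close>.\<close>
    define v where "v = c - (c - m) * exp (- (L * t))"
    have "exp (- (L * t)) \<le> 1"
      using \<open>L > 0\<close> \<open>t \<ge> 0\<close> by simp
    then have "(c - m) * exp (- (L * t)) \<le> c - m"
      using \<open>m < c\<close> by (simp add: mult_left_le)
    then have v: "m \<le> v" "v < c"
      using \<open>m < c\<close> unfolding v_def by (linarith, simp)
    have "ln ((c - m) / (c - v)) / L = t"
      using \<open>m < c\<close> \<open>L > 0\<close> by (simp add: v_def exp_minus inverse_eq_divide)
    then have "t \<le> T v"
      using T_log[OF v] T_less[of a m] T_a assms(1,2) by simp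
    then obtain x where "a \<le> x" "x \<le> v" "T x = t"
      using IVT'[of T a t v] T_a T_cont[of v] v \<open>a < m\<close> \<open>t \<ge> 0\<close> by auto
    then show ?thesis
      using v by auto
  qed
  then obtain w0 where w0: "\<And>t. t \<ge> 0 \<Longrightarrow> a \<le> w0 t \<and> w0 t < c \<and> T (w0 t) = t"
    by metis
  have T_inj: "x = y" if "T x = T y" "a \<le> x" "a \<le> y" "x < c" "y < c" for x y
    using T_less[of x y] T_less[of y x] that by (cases x y rule: linorder_cases) auto
  \<comment> \<open>Extended linearly to negative times, the inverse of \<^term>\<open>T\<close> is an increasing function
    with open image, hence continuous, also at time \<open>0\<close>.\<close>
  define w where "w t = (if t < 0 then a + t else w0 t)" for t
  have w: "a \<le> w t" "w t < c" "T (w t) = t" if "t \<ge> 0" for t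
    using w0[OF that] that by (auto simp: w_def)
  have w_0: "w 0 = a"
    using T_inj[of "w 0" a] w[of 0] T_a \<open>a < c\<close> by simp
  have w_gt: "a < w t" if "t > 0" for t
    using w[of t] that T_a by (cases "w t = a") auto
  have "w ` UNIV = {..<c}"
  proof (intro equalityI subsetI)
    fix y assume "y \<in> w ` UNIV"
    then show "y \<in> {..<c}"
      using w0 \<open>a < c\<close> by (auto simp: w_def not_less intro: less_trans)
  next
    fix y assume y: "y \<in> {..<c}"
    show "y \<in> w ` UNIV"
    proof (cases "y < a")
      case True
      then have "y = w (y - a)"
        by (simp add: w_def)
      then show ?thesis
        by blast
    next
      case False
      then have "T y \<ge> 0"
        using T_less[of a y] T_a y by (cases "y = a") auto
      then have "y = w (T y)"
        using w[of "T y"] T_inj[of y "w (T y)"] False y by simp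
      then show ?thesis
        by blast
    qed
  qed
  moreover have "w s \<le> w t" if "s \<le> t" for s t
  proof (cases "s < 0")
    case True
    then show ?thesis
      using that w[of t] by (cases "t < 0") (auto simp: w_def)
  next
    case False
    then show ?thesis
      using that w[of s] w[of t] T_less[of "w t" "w s"] by (cases "w t < w s") auto
  qed
  ultimately have w_cont: "continuous_on UNIV w"
    by (intro continuous_onI_mono) auto
  show thesis
  proof (rule that[of w])
    show "continuous_on {0..} w"
      using w_cont continuous_on_subset by blast
    show "w 0 = a"
      by (rule w_0)
    show "a < w t \<and> w t < c" if "t > 0" for t
      using w_gt w that by auto
    show "(w has_real_derivative h (w t)) (at t)" if "t > 0" for t
    proof -
      have "(w has_real_derivative inverse (1 / h (w t))) (at t)"
      proof (rule DERIV_inverse_function[where f = T and a = 0 and b = "t + 1"])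
        show "(T has_real_derivative 1 / h (w t)) (at (w t))"
          using T_deriv w_gt w that by simp
        show "1 / h (w t) \<noteq> 0"
          using pos[of "w t"] w_gt w that by fastforce
        show "isCont w t"
          using w_cont by (simp add: continuous_on_eq_continuous_at)
      qed (use that w in auto)
      then show ?thesis
        by simp
    qed
  qed
qed

section \<open>Well-posedness of the radial equation\<close>

text \<open>Allows a solution to be replaced by its extensional representative, which the definite
  description in \<open>W\<close> asks for.\<close>

lemma W_solution_cong:
  assumes "W_solution G \<gamma>\<^sub>0 \<alpha> w" and eq: "\<And>r. r \<ge> 1 \<Longrightarrow> v r = w r"
  shows "W_solution G \<gamma>\<^sub>0 \<alpha> v"
proof -
  have deriv: "(v has_vector_derivative D) (at r)"
    if "(w has_vector_derivative D) (at r)" "r > 1" for D r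
    by (rule has_vector_derivative_transform_within_open[OF that(1), of "{1<..}"])
      (use that eq in auto)
  have "continuous_on {1..} v"
    using assms(1) continuous_on_eq[of "{1..}" w v] by (simp add: W_solution_def eq)
  moreover have "v C1_differentiable_on {1<..}"
    using assms(1) deriv unfolding W_solution_def C1_differentiable_on_def
    by (metis greaterThan_iff)
  ultimately show ?thesis
    using assms(1) deriv unfolding W_solution_def
    by (simp add: eq has_real_derivative_iff_has_vector_derivative)
qed

text \<open>What the analysis of the equation uses from \<open>g\<close>. \<open>G_tangent\<close>
  is the supporting line at the fixed point; \<open>G_upper\<close> is the matching bound with
  quadratic error, stated above \<open>c\<close>, because below \<open>c\<close> the supporting line
  already pushes \<open>w\<close> towards \<open>c\<close> at full speed.\<close>

locale radial_flow =
  fixes G :: "real \<Rightarrow> real" and \<gamma>\<^sub>0 c K :: real and N :: nat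
  assumes N: "N \<ge> 3" and \<gamma>\<^sub>0_less: "\<gamma>\<^sub>0 < c" and K: "K \<ge> 0"
    and G_convex: "convex_on {\<gamma>\<^sub>0<..} G"
    and G_anti: "\<gamma>\<^sub>0 < x \<Longrightarrow> x \<le> y \<Longrightarrow> G y \<le> G x"
    and G_fix: "G c = c"
    and G_tangent: "\<gamma>\<^sub>0 < x \<Longrightarrow> c - (real N - 1) * (x - c) \<le> G x"
    and G_upper: "c < x \<Longrightarrow> G x \<le> c - (real N - 1) * (x - c) + K * (x - c)\<^sup>2"
begin

lemma G_cont: "continuous_on {\<gamma>\<^sub>0<..} G"
  using G_convex by (intro convex_on_continuous) auto

text \<open>Continuous differentiability is automatic: a convex \<open>G\<close> is continuous, so
  the right-hand side is continuous along \<open>w\<close>.\<close>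

lemma W_solutionI:
  assumes "continuous_on {1..} w" "w 1 = \<alpha>" "\<And>r. r > 1 \<Longrightarrow> w r > \<gamma>\<^sub>0"
    and deriv: "\<And>r. r > 1 \<Longrightarrow> (w has_real_derivative (G (w r) - w r) / r) (at r)"
  shows "W_solution G \<gamma>\<^sub>0 \<alpha> w"
proof -
  have w: "continuous_on {1<..} w"
    using assms(1) by (rule continuous_on_subset) auto
  have "continuous_on {1<..} (\<lambda>r. G (w r))"
    by (rule continuous_on_compose2[OF G_cont w]) (use assms(3) in auto)
  then have "continuous_on {1<..} (\<lambda>r. (G (w r) - w r) / r)"
    using w by (intro continuous_intros) auto
  then have "w C1_differentiable_on {1<..}"
    unfolding C1_differentiable_on_def using deriv
    by (intro exI[of _ "\<lambda>r. (G (w r) - w r) / r"])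
      (auto simp: has_real_derivative_iff_has_vector_derivative)
  then show ?thesis
    unfolding W_solution_def using assms by blast
qed

text \<open>In the time variable log r the equation is autonomous. Solutions starting below
  \<open>c\<close> increase and those starting above decrease; reflection
  \<open>w \<mapsto> - w\<close> reduces the second case to the first.\<close>

lemma W_solution_exists:
  assumes "\<alpha> \<ge> \<gamma>\<^sub>0"
  shows "\<exists>w. W_solution G \<gamma>\<^sub>0 \<alpha> w"
proof -
  have cont_h: "continuous_on {\<gamma>\<^sub>0<..} (\<lambda>v. G v - v)"
    using G_cont by (intro continuous_intros)
  consider "\<alpha> = c" | "\<alpha> < c" | "\<alpha> > c"
    by linarith
  then show ?thesis
  proof cases
    case 1
    then have "W_solution G \<gamma>\<^sub>0 \<alpha> (\<lambda>_. c)"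
      using \<gamma>\<^sub>0_less by (intro W_solutionI) (auto simp: G_fix)
    then show ?thesis
      by blast
  next
    case 2
    \<comment> \<open>\<open>G\<close> is not controlled at \<open>\<alpha>\<close> itself when
      \<open>\<alpha> = \<gamma>\<^sub>0\<close>. On \<open>[m, c]\<close> the chord of the convex
      function \<open>G\<close> gives the linear bound with constant
      \<open>(G m - c) / (c - m) + 1\<close>.\<close>
    define m where "m = (\<alpha> + c) / 2"
    have m: "\<alpha> < m" "m < c"
      using 2 by (auto simp: m_def)
    obtain v where v: "continuous_on {0..} v" "v 0 = \<alpha>"
      "\<And>t. t > 0 \<Longrightarrow> \<alpha> < v t \<and> v t < c"
      "\<And>t. t > 0 \<Longrightarrow> (v has_real_derivative G (v t) - v t) (at t)"
    proof (rule autonomous_ode_exists[of \<alpha> m c "\<lambda>v. G v - v" "(G m - c) / (c - m) + 1"])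
      show "continuous_on {\<alpha><..<c} (\<lambda>v. G v - v)"
        by (rule continuous_on_subset[OF cont_h]) (use assms in auto)
      show "G y - y \<le> G x - x" if "\<alpha> < x" "x \<le> y" for x y
        using G_anti[of x y] that assms by linarith
      show "0 < G x - x" if "\<alpha> < x" "x < c" for x
        using G_anti[of x c] G_fix that assms by linarith
      show "G x - x \<le> ((G m - c) / (c - m) + 1) * (c - x)" if "m \<le> x" "x < c" for x
      proof -
        define t where "t = (c - x) / (c - m)"
        have t: "0 \<le> t" "t \<le> 1" "t * (c - m) = c - x"
          using that m by (auto simp: t_def)
        have "G ((1 - t) *\<^sub>R c + t *\<^sub>R m) \<le> (1 - t) * G c + t * G m"
          using t m assms by (intro convex_onD[OF G_convex]) auto
        moreover have "(1 - t) *\<^sub>R c + t *\<^sub>R m = x"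
          using t by (simp add: algebra_simps)
        ultimately have "G x \<le> c + t * (G m - c)"
          by (simp add: G_fix algebra_simps)
        then show ?thesis
          by (simp add: t_def field_simps)
      qed
    qed (use m in auto)
    have "W_solution G \<gamma>\<^sub>0 \<alpha> (\<lambda>r. v (ln r))"
    proof (rule W_solutionI)
      show "continuous_on {1..} (\<lambda>r. v (ln r))"
        by (rule continuous_on_compose2[OF v(1)]) (auto intro!: continuous_intros)
      show "((\<lambda>r. v (ln r)) has_real_derivative (G (v (ln r)) - v (ln r)) / r) (at r)"
        if "r > 1" for r
        using DERIV_chain2[OF v(4)[of "ln r"] DERIV_ln_divide[of r]] that by simp
      show "\<gamma>\<^sub>0 < v (ln r)" if "r > 1" for r
        using v(3)[of "ln r"] that assms by simp
    qed (simp add: v)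
    then show ?thesis
      by blast
  next
    case 3
    \<comment> \<open>After reflection the linear bound comes from \<open>G_tangent\<close>: slope
      \<open>N - 1\<close> from \<open>G\<close> and 1 from the term \<open>- w\<close>.\<close>
    define m where "m = (- \<alpha> - c) / 2"
    have m: "- \<alpha> < m" "m < - c"
      using 3 by (auto simp: m_def)
    obtain v where v: "continuous_on {0..} v" "v 0 = - \<alpha>"
      "\<And>t. t > 0 \<Longrightarrow> - \<alpha> < v t \<and> v t < - c"
      "\<And>t. t > 0 \<Longrightarrow> (v has_real_derivative - (G (- v t) - (- v t))) (at t)"
    proof (rule autonomous_ode_exists[of "- \<alpha>" m "- c" "\<lambda>v. - (G (- v) - (- v))" "real N"])
      show "continuous_on {- \<alpha><..<- c} (\<lambda>v. - (G (- v) - (- v)))"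
        by (intro continuous_on_minus continuous_on_compose2[OF cont_h])
          (use \<gamma>\<^sub>0_less in \<open>auto intro: continuous_intros\<close>)
      show "- (G (- y) - (- y)) \<le> - (G (- x) - (- x))" if "x \<le> y" "y < - c" for x y
        using G_anti[of "- y" "- x"] that \<gamma>\<^sub>0_less by linarith
      show "0 < - (G (- x) - (- x))" if "x < - c" for x
        using G_anti[of c "- x"] G_fix that \<gamma>\<^sub>0_less by linarith
      show "- (G (- x) - (- x)) \<le> real N * (- c - x)" if "x < - c" for x
        using G_tangent[of "- x"] that \<gamma>\<^sub>0_less by (simp add: algebra_simps)
    qed (use m in auto)
    have "W_solution G \<gamma>\<^sub>0 \<alpha> (\<lambda>r. - v (ln r))"
    proof (rule W_solutionI)
      show "continuous_on {1..} (\<lambda>r. - v (ln r))"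
        by (intro continuous_on_minus continuous_on_compose2[OF v(1)])
          (auto intro!: continuous_intros)
      show "((\<lambda>r. - v (ln r)) has_real_derivative (G (- v (ln r)) - - v (ln r)) / r) (at r)"
        if "r > 1" for r
        using DERIV_minus[OF DERIV_chain2[OF v(4)[of "ln r"] DERIV_ln_divide[of r]]] that
        by (simp add: minus_divide_left add.commute)
      show "\<gamma>\<^sub>0 < - v (ln r)" if "r > 1" for r
        using v(3)[of "ln r"] that \<gamma>\<^sub>0_less by simp
    qed (simp add: v)
    then show ?thesis
      by blast
  qed
qed

lemma W_solutionD:
  assumes "W_solution G \<gamma>\<^sub>0 \<alpha> w"
  shows "continuous_on {1..} w" "w 1 = \<alpha>" "\<And>r. r > 1 \<Longrightarrow> w r > \<gamma>\<^sub>0"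
    "\<And>r. r > 1 \<Longrightarrow> (w has_real_derivative (G (w r) - w r) / r) (at r)"
  using assms unfolding W_solution_def by auto

text \<open>\<open>G v - v\<close> is antitone, so the square of the difference of two solutions has
  nonpositive derivative on the open interval; at the left end only continuity enters, which admits
  the start \<open>\<gamma>\<^sub>0\<close>. Uniqueness, preservation of order and 1-Lipschitz
  dependence on the initial value all come from here.\<close>

lemma W_solution_contract:
  assumes w: "W_solution G \<gamma>\<^sub>0 \<alpha> w" and v: "W_solution G \<gamma>\<^sub>0 \<beta> v" and r: "1 \<le> s" "s \<le> r"
  shows "\<bar>w r - v r\<bar> \<le> \<bar>w s - v s\<bar>"
proof -
  note w = W_solutionD[OF w] and v = W_solutionD[OF v]
  have "(w r - v r)\<^sup>2 \<le> (w s - v s)\<^sup>2"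
  proof (rule DERIV_nonpos_imp_decreasing_open[OF \<open>s \<le> r\<close>])
    have "continuous_on {1..} (\<lambda>r. (w r - v r)\<^sup>2)"
      by (intro continuous_intros w v)
    then show "continuous_on {s..r} (\<lambda>r. (w r - v r)\<^sup>2)"
      by (rule continuous_on_subset) (use r in auto)
    fix x assume x: "s < x" "x < r"
    then have x1: "x > 1"
      using r by simp
    let ?d = "2 * ((w x - v x) * ((G (w x) - w x) - (G (v x) - v x))) / x"
    have "((\<lambda>r. (w r - v r)\<^sup>2) has_real_derivative ?d) (at x)"
      using x1 by (auto intro!: derivative_eq_intros w v simp: field_simps power2_eq_square)
    moreover have "(w x - v x) * ((G (w x) - w x) - (G (v x) - v x)) \<le> 0"
      using G_anti[of "w x" "v x"] G_anti[of "v x" "w x"] w(3)[OF x1] v(3)[OF x1]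
      by (cases "w x \<le> v x") (auto simp: mult_le_0_iff)
    then have "?d \<le> 0"
      using x1 by (simp add: divide_nonpos_pos)
    ultimately show "\<exists>y. ((\<lambda>r. (w r - v r)\<^sup>2) has_real_derivative y) (at x) \<and> y \<le> 0"
      by blast
  qed
  then show ?thesis
    by (simp add: abs_le_square_iff)
qed

text \<open>Existence and contraction from \<open>s = 1\<close> justify the definite description in
  \<open>W\<close>.\<close>

lemma W_solution_W:
  assumes "\<alpha> \<ge> \<gamma>\<^sub>0"
  shows "W_solution G \<gamma>\<^sub>0 \<alpha> (\<lambda>r. W G \<gamma>\<^sub>0 r \<alpha>)"
proof -
  obtain w where w: "W_solution G \<gamma>\<^sub>0 \<alpha> w"
    using W_solution_exists[OF assms] by blast
  have "\<exists>!w. w \<in> extensional {1..} \<and> W_solution G \<gamma>\<^sub>0 \<alpha> w"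
  proof (rule ex1I[of _ "restrict w {1..}"])
    show "restrict w {1..} \<in> extensional {1..} \<and> W_solution G \<gamma>\<^sub>0 \<alpha> (restrict w {1..})"
      using W_solution_cong[OF w] by simp
    fix v assume v: "v \<in> extensional {1..} \<and> W_solution G \<gamma>\<^sub>0 \<alpha> v"
    then have "v r = w r" if "r \<ge> 1" for r
      using W_solution_contract[OF _ w, of \<alpha> v 1 r] that W_solutionD(2)[OF w]
        W_solutionD(2)[of \<alpha> v] by simp
    then show "v = restrict w {1..}"
      using v by (auto simp: extensional_def restrict_def fun_eq_iff)
  qed
  from theI'[OF this] show ?thesis
    by (simp add: W_def[abs_def])
qed

lemma W_solution_unique:
  assumes w: "W_solution G \<gamma>\<^sub>0 \<alpha> w" and "\<alpha> \<ge> \<gamma>\<^sub>0" "r \<ge> 1"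
  shows "w r = W G \<gamma>\<^sub>0 r \<alpha>"
  using W_solution_contract[OF w W_solution_W, of \<alpha> 1 r] assms
    W_solutionD(2)[OF w] W_solutionD(2)[OF W_solution_W, of \<alpha>] by simp

section \<open>Decay towards the fixed point\<close>

lemma contraction_to_c:
  assumes "\<gamma>\<^sub>0 < x"
  shows "(x - c) * (G x - c) \<le> 0"
  using G_anti[of x c] G_anti[of c x] G_fix assms \<gamma>\<^sub>0_less
  by (cases "x \<le> c") (auto simp: mult_le_0_iff)

text \<open>Energy form of the linearization with rate \<open>N\<close>. Below \<open>c\<close> the
  supporting line gives it without error; above \<open>c\<close> the error is the quadratic term of
  \<open>G_upper\<close>.\<close>

lemma linearized_decay:
  assumes "\<gamma>\<^sub>0 < x"
  shows "(x - c) * (G x - x) + N * (x - c)\<^sup>2 \<le> K * \<bar>x - c\<bar> * (x - c)\<^sup>2"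
proof (cases "x \<le> c")
  case True
  have "(x - c) * (G x - x + N * (x - c)) \<le> 0"
    using G_tangent[OF assms] True by (intro mult_nonpos_nonneg) (auto simp: algebra_simps)
  moreover have "0 \<le> K * \<bar>x - c\<bar> * (x - c)\<^sup>2"
    using K by simp
  ultimately show ?thesis
    by (simp add: algebra_simps power2_eq_square)
next
  case False
  then have "(x - c) * (G x - x + N * (x - c)) \<le> (x - c) * (K * (x - c)\<^sup>2)"
    using G_upper[of x] by (intro mult_left_mono) (auto simp: algebra_simps)
  then show ?thesis
    using False by (simp add: algebra_simps power2_eq_square)
qed

text \<open>The derivative of \<open>(w - c) * r\<close> is \<open>G w - c\<close>, whose sign is
  opposite to that of \<open>w - c\<close>. This crude rate is the input that makes the quadratic
  error harmless in the sharp estimate.\<close>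

lemma W_solution_decay_linear:
  assumes "W_solution G \<gamma>\<^sub>0 \<alpha> w" "r \<ge> 1"
  shows "\<bar>w r - c\<bar> \<le> \<bar>\<alpha> - c\<bar> / r"
proof -
  note w = W_solutionD[OF assms(1)]
  have "((w r - c) * r)\<^sup>2 \<le> ((w 1 - c) * 1)\<^sup>2"
  proof (rule DERIV_nonpos_imp_decreasing_open[OF \<open>r \<ge> 1\<close>])
    have "continuous_on {1..} (\<lambda>r. ((w r - c) * r)\<^sup>2)"
      by (intro continuous_intros w)
    then show "continuous_on {1..r} (\<lambda>r. ((w r - c) * r)\<^sup>2)"
      by (rule continuous_on_subset) auto
    fix x assume x: "1 < x" "x < r"
    let ?d = "2 * x * ((w x - c) * (G (w x) - c))"
    have "((\<lambda>r. ((w r - c) * r)\<^sup>2) has_real_derivative ?d) (at x)"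
      using x by (auto intro!: derivative_eq_intros w simp: field_simps power2_eq_square)
    moreover have "?d \<le> 0"
      using x contraction_to_c[OF w(3)[of x]] by (intro mult_nonneg_nonpos[of "2 * x"]) simp_all
    ultimately show "\<exists>y. ((\<lambda>r. ((w r - c) * r)\<^sup>2) has_real_derivative y) (at x) \<and> y \<le> 0"
      by blast
  qed
  then have "\<bar>(w r - c) * r\<bar> \<le> \<bar>\<alpha> - c\<bar>"
    using w(2) by (simp add: abs_le_square_iff)
  then show ?thesis
    using assms(2) by (simp add: abs_mult pos_le_divide_eq)
qed

text \<open>Square root of the value at \<open>r = 1\<close> of the weighted energy \<open>E\<close>
  used for the sharp rate. Its continuity in \<open>\<alpha>\<close> later provides a common
  majorant for convergent initial values.\<close>

definition decay_const :: "real \<Rightarrow> real" where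
  "decay_const \<alpha> = \<bar>\<alpha> - c\<bar> * exp (K * \<bar>\<alpha> - c\<bar>)"

lemma W_solution_decay:
  assumes "W_solution G \<gamma>\<^sub>0 \<alpha> w" "r \<ge> 1"
  shows "\<bar>w r - c\<bar> \<le> decay_const \<alpha> / r ^ N"
proof -
  note w = W_solutionD[OF assms(1)]
  define Y where "Y = \<bar>\<alpha> - c\<bar>"
  \<comment> \<open>The factor \<open>exp (2KY/r)\<close> absorbs the quadratic error of the linearization, since
    \<open>\<bar>w - c\<bar> \<le> Y/r\<close>.\<close>
  define E where "E r = (w r - c)\<^sup>2 * r ^ (2 * N) * exp (2 * K * Y / r)" for r
  have "E r \<le> E 1"
  proof (rule DERIV_nonpos_imp_decreasing_open[OF \<open>r \<ge> 1\<close>])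
    have "continuous_on {1..} E"
      unfolding E_def by (intro continuous_intros w) auto
    then show "continuous_on {1..r} E"
      by (rule continuous_on_subset) auto
    fix x assume x: "1 < x" "x < r"
    let ?A = "(w x - c) * (G (w x) - w x) + N * (w x - c)\<^sup>2 - K * (Y / x) * (w x - c)\<^sup>2"
    let ?d = "2 * exp (2 * K * Y / x) * x ^ (2 * N) / x * ?A"
    have "((\<lambda>r. (w r - c)\<^sup>2) has_real_derivative 2 * (w x - c) * ((G (w x) - w x) / x)) (at x)"
      using x by (auto intro!: derivative_eq_intros w)
    moreover have "((\<lambda>r. r ^ (2 * N)) has_real_derivative 2 * N * x ^ (2 * N) / x) (at x)"
      using x N DERIV_pow[of "2 * N" x UNIV] by (simp add: power_diff)
    moreover have "((\<lambda>r. exp (2 * K * Y / r)) has_real_derivative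
        - (2 * K * Y / x\<^sup>2) * exp (2 * K * Y / x)) (at x)"
      using x by (auto intro!: derivative_eq_intros simp: power2_eq_square)
    ultimately have "(E has_real_derivative
        (2 * (w x - c) * ((G (w x) - w x) / x) * x ^ (2 * N) + 2 * N * x ^ (2 * N) / x * (w x - c)\<^sup>2)
          * exp (2 * K * Y / x)
        + - (2 * K * Y / x\<^sup>2) * exp (2 * K * Y / x) * ((w x - c)\<^sup>2 * x ^ (2 * N))) (at x)"
      unfolding E_def by (intro DERIV_mult)
    moreover have "(2 * y * (h / x) * P + 2 * N * P / x * y\<^sup>2) * e + - (2 * K * Y / x\<^sup>2) * e * (y\<^sup>2 * P)
        = 2 * e * P / x * (y * h + N * y\<^sup>2 - K * (Y / x) * y\<^sup>2)" for y h P e :: real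
      using x by (simp add: field_simps power2_eq_square)
    ultimately have "(E has_real_derivative ?d) (at x)"
      by (simp only:)
    moreover have "K * \<bar>w x - c\<bar> * (w x - c)\<^sup>2 \<le> K * (Y / x) * (w x - c)\<^sup>2"
      using W_solution_decay_linear[OF assms(1), of x] x K
      by (intro mult_right_mono mult_left_mono) (auto simp: Y_def)
    then have "?A \<le> 0"
      using linearized_decay[OF w(3)] x by fastforce
    then have "?d \<le> 0"
      using x by (intro mult_nonneg_nonpos) auto
    ultimately show "\<exists>y. (E has_real_derivative y) (at x) \<and> y \<le> 0"
      by blast
  qed
  moreover have "((w r - c) * r ^ N)\<^sup>2 \<le> E r"
  proof -
    have "(w r - c)\<^sup>2 * r ^ (2 * N) * 1 \<le> E r"
      unfolding E_def using assms(2) K by (intro mult_left_mono) (auto simp: Y_def)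
    then show ?thesis
      by (simp add: power_mult_distrib power_mult[symmetric] mult.commute)
  qed
  moreover have "E 1 = (decay_const \<alpha>)\<^sup>2"
    by (simp add: E_def decay_const_def Y_def w(2) power_mult_distrib mult_exp_exp
        power2_eq_square[of "exp _"])
  ultimately have "((w r - c) * r ^ N)\<^sup>2 \<le> (decay_const \<alpha>)\<^sup>2"
    by simp
  then have "\<bar>(w r - c) * r ^ N\<bar> \<le> decay_const \<alpha>"
    by (simp add: abs_le_square_iff[symmetric] decay_const_def)
  then show ?thesis
    using assms(2) by (simp add: abs_mult pos_le_divide_eq)
qed

text \<open>By \<open>G_tangent\<close> the function \<open>(w - c) * r ^ N\<close> is
  nondecreasing. For \<open>\<alpha> > c\<close> this prevents decay faster than
  \<open>r ^ N\<close> and yields the linear growth of \<mu>.\<close>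

lemma W_solution_lower:
  assumes "W_solution G \<gamma>\<^sub>0 \<alpha> w" "r \<ge> 1"
  shows "(\<alpha> - c) / r ^ N \<le> w r - c"
proof -
  note w = W_solutionD[OF assms(1)]
  have "(w 1 - c) * 1 ^ N \<le> (w r - c) * r ^ N"
  proof (rule DERIV_nonneg_imp_increasing_open[OF \<open>r \<ge> 1\<close>])
    have "continuous_on {1..} (\<lambda>r. (w r - c) * r ^ N)"
      by (intro continuous_intros w)
    then show "continuous_on {1..r} (\<lambda>r. (w r - c) * r ^ N)"
      by (rule continuous_on_subset) auto
    fix x assume x: "1 < x" "x < r"
    let ?d = "x ^ N / x * (G (w x) - w x + N * (w x - c))"
    have "((\<lambda>r. r ^ N) has_real_derivative N * x ^ N / x) (at x)"
      using x N DERIV_pow[of N x UNIV] by (simp add: power_diff)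
    moreover have "((\<lambda>r. w r - c) has_real_derivative (G (w x) - w x) / x) (at x)"
      using x by (auto intro!: derivative_eq_intros w)
    ultimately have "((\<lambda>r. (w r - c) * r ^ N) has_real_derivative
        (G (w x) - w x) / x * x ^ N + N * x ^ N / x * (w x - c)) (at x)"
      by (intro DERIV_mult)
    moreover have "(G (w x) - w x) / x * x ^ N + N * x ^ N / x * (w x - c) = ?d"
      by (simp add: algebra_simps add_divide_distrib diff_divide_distrib)
    ultimately have "((\<lambda>r. (w r - c) * r ^ N) has_real_derivative ?d) (at x)"
      by simp
    moreover have "0 \<le> ?d"
      using x G_tangent[OF w(3)[OF x(1)]] by (intro mult_nonneg_nonneg) (auto simp: algebra_simps)
    ultimately show "\<exists>y. ((\<lambda>r. (w r - c) * r ^ N) has_real_derivative y) (at x) \<and> 0 \<le> y"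
      by blast
  qed
  then show ?thesis
    using assms(2) w(2) by (simp add: field_simps)
qed

text \<open>If the order were reversed at \<open>r\<close>, the solutions would meet somewhere in
  between, and contraction would keep them equal from there on.\<close>

lemma W_solution_mono:
  assumes w: "W_solution G \<gamma>\<^sub>0 \<alpha> w" and v: "W_solution G \<gamma>\<^sub>0 \<beta> v" and "\<alpha> < \<beta>" "r \<ge> 1"
  shows "w r \<le> v r"
proof (rule ccontr)
  assume "\<not> w r \<le> v r"
  moreover have "continuous_on {1..} (\<lambda>r. w r - v r)"
    by (intro continuous_intros W_solutionD(1)[OF w] W_solutionD(1)[OF v])
  then have "continuous_on {1..r} (\<lambda>r. w r - v r)"
    by (rule continuous_on_subset) auto
  ultimately obtain s where s: "1 \<le> s" "s \<le> r" "w s - v s = 0"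
    using IVT'[of "\<lambda>r. w r - v r" 1 0 r] assms W_solutionD(2)[OF w] W_solutionD(2)[OF v] by auto
  then show False
    using W_solution_contract[OF w v s(1,2)] \<open>\<not> w r \<le> v r\<close> by simp
qed

section \<open>The function \<mu>: convergence, strict monotonicity, continuity, range\<close>

abbreviation excess :: "real \<Rightarrow> real \<Rightarrow> real" where
  "excess \<alpha> s \<equiv> s * (W G \<gamma>\<^sub>0 s \<alpha> - c)"

lemma decay_const_nonneg: "0 \<le> decay_const \<alpha>"
  by (simp add: decay_const_def)

text \<open>The factor \<open>s\<close> costs one power of the decay; since
  \<open>N \<ge> 3\<close>, the remaining exponent \<open>N - 1\<close> is still integrable at
  infinity.\<close>

lemma excess_bound:
  assumes "\<alpha> \<ge> \<gamma>\<^sub>0" "s \<ge> 1"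
  shows "\<bar>excess \<alpha> s\<bar> \<le> decay_const \<alpha> * (1 / s ^ (N - 1))"
proof -
  have "\<bar>excess \<alpha> s\<bar> \<le> s * (decay_const \<alpha> / s ^ N)"
    using mult_left_mono[OF W_solution_decay[OF W_solution_W[OF assms(1)] assms(2)], of s] assms
    by (simp add: abs_mult)
  also have "\<dots> = decay_const \<alpha> * (1 / s ^ (N - 1))"
    using assms N by (simp add: power_diff)
  finally show ?thesis .
qed

lemma excess_cont: "\<alpha> \<ge> \<gamma>\<^sub>0 \<Longrightarrow> continuous_on {1..} (excess \<alpha>)"
  by (intro continuous_intros W_solutionD(1)[OF W_solution_W])

lemma inverse_power_integral:
  assumes "R \<ge> 1"
  shows "((\<lambda>s. B * (1 / s ^ (N - 1))) has_integral B * (1 / (real (N - 2) * R ^ (N - 2)))) {R..}"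
  using has_integral_mult_right[OF has_integral_inverse_power_to_inf[of "N - 1" R], of B] assms N
  by (simp add: numeral_2_eq_2)

lemma excess_integrable:
  assumes "\<alpha> \<ge> \<gamma>\<^sub>0" "R \<ge> 1"
  shows "excess \<alpha> integrable_on {R..}"
proof (rule measurable_bounded_by_integrable_imp_integrable)
  show "(\<lambda>s. decay_const \<alpha> * (1 / s ^ (N - 1))) integrable_on {R..}"
    using inverse_power_integral[OF assms(2)] by blast
  show "excess \<alpha> \<in> borel_measurable (lebesgue_on {R..})"
    using assms(2) by (intro continuous_imp_measurable_on_sets_lebesgue
        continuous_on_subset[OF excess_cont[OF assms(1)]]) auto
qed (use excess_bound assms in auto)

text \<open>The difference is the tail integral over \<open>{R..}\<close>. This is the source of the
  error term O(|x|^(2-n)) in the expansion.\<close>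

lemma \<mu>_partial:
  assumes "\<alpha> \<ge> \<gamma>\<^sub>0" "R \<ge> 1"
  shows "\<bar>integral {1..R} (excess \<alpha>) - \<mu> G \<gamma>\<^sub>0 c \<alpha>\<bar> \<le> decay_const \<alpha> / R ^ (N - 2)"
proof -
  have "{1..} = {1..R} \<union> {R..}" "{1..R} \<inter> {R..} = {R}"
    using assms(2) by auto
  moreover have "excess \<alpha> integrable_on {1..R}"
    by (intro integrable_continuous_real continuous_on_subset[OF excess_cont[OF assms(1)]]) auto
  ultimately have "\<mu> G \<gamma>\<^sub>0 c \<alpha> = integral {1..R} (excess \<alpha>) + integral {R..} (excess \<alpha>)"
    using excess_integrable[OF assms] by (simp add: \<mu>_def)
  moreover have "norm (integral {R..} (excess \<alpha>))
      \<le> integral {R..} (\<lambda>s. decay_const \<alpha> * (1 / s ^ (N - 1)))"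
    using inverse_power_integral[OF assms(2)] excess_bound[OF assms(1)] assms
    by (intro integral_norm_bound_integral excess_integrable) auto
  moreover have "integral {R..} (\<lambda>s. decay_const \<alpha> * (1 / s ^ (N - 1)))
      = decay_const \<alpha> * (1 / (real (N - 2) * R ^ (N - 2)))"
    using inverse_power_integral[OF assms(2)] by (rule integral_unique)
  \<comment> \<open>\<open>N - 2 \<ge> 1\<close>, so the factor from integrating the power only
    helps.\<close>
  moreover have "decay_const \<alpha> * (1 / (real (N - 2) * R ^ (N - 2))) \<le> decay_const \<alpha> * (1 / R ^ (N - 2))"
    using N assms(2) decay_const_nonneg by (intro mult_left_mono frac_le) auto
  ultimately show ?thesis
    by simp
qed

text \<open>Preservation of order makes the integrands comparable only weakly. Strictness comes from
  a neighbourhood of \<open>s = 1\<close>, where by continuity the gap is still at least half of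
  \<open>\<beta> - \<alpha>\<close>.\<close>

lemma \<mu>_strict_mono:
  assumes "\<gamma>\<^sub>0 \<le> \<alpha>" "\<alpha> < \<beta>"
  shows "\<mu> G \<gamma>\<^sub>0 c \<alpha> < \<mu> G \<gamma>\<^sub>0 c \<beta>"
proof -
  have "\<gamma>\<^sub>0 \<le> \<beta>"
    using assms by simp
  note W\<alpha> = W_solution_W[OF assms(1)] and W\<beta> = W_solution_W[OF \<open>\<gamma>\<^sub>0 \<le> \<beta>\<close>]
  define D where "D s = W G \<gamma>\<^sub>0 s \<beta> - W G \<gamma>\<^sub>0 s \<alpha>" for s
  define \<delta> where "\<delta> = (\<beta> - \<alpha>) / 2"
  have "continuous_on {1..} D"
    unfolding D_def by (intro continuous_intros W_solutionD(1)[OF W\<alpha>] W_solutionD(1)[OF W\<beta>])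
  moreover have "D 1 = \<beta> - \<alpha>"
    by (simp add: D_def W_solutionD(2)[OF W\<alpha>] W_solutionD(2)[OF W\<beta>])
  moreover have "\<delta> > 0"
    using assms by (simp add: \<delta>_def)
  ultimately obtain e where e: "e > 0" "\<And>s. s \<ge> 1 \<Longrightarrow> dist s 1 < e \<Longrightarrow> dist (D s) (\<beta> - \<alpha>) < \<delta>"
    unfolding continuous_on_iff by (metis atLeast_iff order_refl)
  define R where "R = 1 + e / 2"
  have F: "excess \<beta> s - excess \<alpha> s = s * D s" for s
    by (simp add: D_def algebra_simps)
  have int: "(\<lambda>s. excess \<beta> s - excess \<alpha> s) integrable_on {1..}"
    using assms \<open>\<gamma>\<^sub>0 \<le> \<beta>\<close> by (intro integrable_diff excess_integrable) auto
  have int_R: "(\<lambda>s. excess \<beta> s - excess \<alpha> s) integrable_on {1..R}"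
    by (rule integrable_on_subinterval[OF int]) auto
  have "0 < \<delta> * (R - 1)"
    using \<open>\<delta> > 0\<close> e by (simp add: R_def)
  also have "\<dots> = integral {1..R} (\<lambda>_. \<delta>)"
    using e by (simp add: R_def)
  also have "\<dots> \<le> integral {1..R} (\<lambda>s. excess \<beta> s - excess \<alpha> s)"
  proof (rule integral_le[OF _ int_R])
    show "\<delta> \<le> excess \<beta> s - excess \<alpha> s" if "s \<in> {1..R}" for s
    proof -
      have "\<delta> \<le> D s"
        using e(1) e(2)[of s] that abs_le_D2[of "D s - (\<beta> - \<alpha>)" \<delta>]
        by (simp add: dist_real_def R_def \<delta>_def)
      then have "1 * \<delta> \<le> s * D s"
        using that \<open>\<delta> > 0\<close> by (intro mult_mono) auto
      then show ?thesis
        by (simp add: F)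
    qed
  qed auto
  also have "\<dots> \<le> integral {1..} (\<lambda>s. excess \<beta> s - excess \<alpha> s)"
    using W_solution_mono[OF W\<alpha> W\<beta> assms(2)]
    by (intro integral_subset_le int int_R) (auto simp: F D_def)
  also have "\<dots> = \<mu> G \<gamma>\<^sub>0 c \<beta> - \<mu> G \<gamma>\<^sub>0 c \<alpha>"
    unfolding \<mu>_def using assms \<open>\<gamma>\<^sub>0 \<le> \<beta>\<close> by (intro integral_diff excess_integrable) auto
  finally show ?thesis
    by simp
qed

text \<open>Dominated convergence: contraction gives pointwise convergence of the integrands, and
  boundedness of \<open>decay_const\<close> along the sequence gives the integrable
  majorant.\<close>

lemma \<mu>_cont: "continuous_on {\<gamma>\<^sub>0..} (\<mu> G \<gamma>\<^sub>0 c)"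
proof (rule continuous_on_sequentiallyI)
  fix x \<alpha> assume x: "\<forall>n. x n \<in> {\<gamma>\<^sub>0..}" "\<alpha> \<in> {\<gamma>\<^sub>0..}" "x \<longlonglongrightarrow> \<alpha>"
  have "(\<lambda>n. decay_const (x n)) \<longlonglongrightarrow> decay_const \<alpha>"
    unfolding decay_const_def by (intro tendsto_intros x)
  then have "Bseq (\<lambda>n. decay_const (x n))"
    by (intro convergent_imp_Bseq convergentI)
  then obtain B where B': "\<forall>n. norm (decay_const (x n)) \<le> B"
    by (rule BseqE)
  have B: "decay_const (x n) \<le> B" for n
    using spec[OF B', of n] unfolding real_norm_def by (rule abs_le_D1)
  have "(\<lambda>n. integral {1..} (excess (x n))) \<longlonglongrightarrow> integral {1..} (excess \<alpha>)"
  proof (rule dominated_convergence(2)[where f = "\<lambda>n. excess (x n)" and g = "excess \<alpha>"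
        and h = "\<lambda>s. B * (1 / s ^ (N - 1))"])
    show "excess (x n) integrable_on {1..}" for n
      using x by (intro excess_integrable) auto
    show "(\<lambda>s. B * (1 / s ^ (N - 1))) integrable_on {1..}"
      by (rule has_integral_integrable[OF inverse_power_integral]) simp
    show "norm (excess (x n) s) \<le> B * (1 / s ^ (N - 1))" if "s \<in> {1..}" for n s
    proof -
      have "norm (excess (x n) s) \<le> decay_const (x n) * (1 / s ^ (N - 1))"
        using x(1) excess_bound[of "x n" s] that by simp
      also have "\<dots> \<le> B * (1 / s ^ (N - 1))"
        using B that by (intro mult_right_mono) auto
      finally show ?thesis .
    qed
    show "(\<lambda>n. excess (x n) s) \<longlonglongrightarrow> excess \<alpha> s" if "s \<in> {1..}" for s
    proof -
      have W: "W_solution G \<gamma>\<^sub>0 \<alpha> (\<lambda>r. W G \<gamma>\<^sub>0 r \<alpha>)"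
        "W_solution G \<gamma>\<^sub>0 (x n) (\<lambda>r. W G \<gamma>\<^sub>0 r (x n))" for n
        using x W_solution_W by auto
      have d: "\<bar>W G \<gamma>\<^sub>0 s (x n) - W G \<gamma>\<^sub>0 s \<alpha>\<bar> \<le> \<bar>x n - \<alpha>\<bar>" for n
        using W_solution_contract[OF W(2)[of n] W(1), of 1 s] that
          W_solutionD(2)[OF W(1)] W_solutionD(2)[OF W(2)[of n]] by simp
      have "(\<lambda>n. \<bar>x n - \<alpha>\<bar>) \<longlonglongrightarrow> 0"
        by (intro tendsto_rabs_zero LIM_zero x(3))
      then have "(\<lambda>n. W G \<gamma>\<^sub>0 s (x n) - W G \<gamma>\<^sub>0 s \<alpha>) \<longlonglongrightarrow> 0"
        by (rule Lim_null_comparison[rotated]) (simp add: d)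
      then have "(\<lambda>n. W G \<gamma>\<^sub>0 s (x n)) \<longlonglongrightarrow> W G \<gamma>\<^sub>0 s \<alpha>"
        by (rule LIM_zero_cancel)
      then show ?thesis
        by (intro tendsto_mult tendsto_diff tendsto_const)
    qed
  qed
  then show "(\<lambda>n. \<mu> G \<gamma>\<^sub>0 c (x n)) \<longlonglongrightarrow> \<mu> G \<gamma>\<^sub>0 c \<alpha>"
    by (simp only: \<mu>_def)
qed

lemma \<mu>_lower:
  assumes "\<alpha> \<ge> \<gamma>\<^sub>0"
  shows "(\<alpha> - c) / real (N - 2) \<le> \<mu> G \<gamma>\<^sub>0 c \<alpha>"
proof -
  have "(\<alpha> - c) * (1 / s ^ (N - 1)) \<le> excess \<alpha> s" if "s \<ge> 1" for s
  proof -
    have "(\<alpha> - c) * (1 / s ^ (N - 1)) = s * ((\<alpha> - c) / s ^ N)"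
      using that N by (simp add: power_diff)
    also have "\<dots> \<le> excess \<alpha> s"
      using W_solution_lower[OF W_solution_W[OF assms] that] that by (intro mult_left_mono) auto
    finally show ?thesis .
  qed
  then show ?thesis
    unfolding \<mu>_def
    using has_integral_le[OF inverse_power_integral[of 1 "\<alpha> - c"]
        integrable_integral[OF excess_integrable[OF assms, of 1]]] by simp
qed

lemma \<mu>_surj:
  assumes "y \<ge> \<mu> G \<gamma>\<^sub>0 c \<gamma>\<^sub>0"
  obtains \<alpha> where "\<alpha> \<ge> \<gamma>\<^sub>0" "\<mu> G \<gamma>\<^sub>0 c \<alpha> = y"
proof -
  \<comment> \<open>Solves \<open>(\<beta> - c) / (N - 2) = \<bar>y\<bar>\<close>, so
    \<open>\<mu>_lower\<close> puts \<mu> at \<open>\<beta>\<close> above \<open>y\<close> and the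
    intermediate value theorem applies.\<close>
  define \<beta> where "\<beta> = c + real (N - 2) * \<bar>y\<bar>"
  have \<beta>: "\<beta> \<ge> \<gamma>\<^sub>0"
    using \<gamma>\<^sub>0_less by (simp add: \<beta>_def add_increasing2)
  have "\<bar>y\<bar> \<le> \<mu> G \<gamma>\<^sub>0 c \<beta>"
    using \<mu>_lower[OF \<beta>] N by (simp add: \<beta>_def)
  then show thesis
    using IVT'[of "\<mu> G \<gamma>\<^sub>0 c" \<gamma>\<^sub>0 y \<beta>] assms \<beta> continuous_on_subset[OF \<mu>_cont] that by force
qed

end

section \<open>The function \<open>g\<close>\<close>

lemma bvec_nth [simp]: "bvec k \<beta> \<gamma> $ i = (if i = k then \<beta> else \<gamma>)"
  by (simp add: bvec_def)

lemma bvec_diag: "bvec k \<gamma> \<gamma> = vec \<gamma>"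
  by (simp add: vec_eq_iff)

text \<open>In this locale \<open>c\<close> is the constant c_s of the overview; the additive
  constant of the expansion at infinity is called \<open>d\<close>.\<close>

locale hessian_operator =
  fixes f :: "real^'n::finite \<Rightarrow> real" and \<Gamma> :: "(real^'n) set" and k :: 'n
    and c \<gamma>\<^sub>0 :: real
  assumes card: "CARD('n) \<ge> 3"
    and \<Gamma>_open: "open \<Gamma>"
    and \<Gamma>_convex: "convex \<Gamma>"
    and \<Gamma>_cone: "\<And>x t. x \<in> \<Gamma> \<Longrightarrow> t > 0 \<Longrightarrow> t *\<^sub>R x \<in> \<Gamma>"
    and \<Gamma>_sym: "\<And>p x. p permutes UNIV \<Longrightarrow> x \<in> \<Gamma> \<Longrightarrow> (\<chi> i. x $ p i) \<in> \<Gamma>"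
    and \<Gamma>_pos: "\<And>x. (\<And>j. x $ j > 0) \<Longrightarrow> x \<in> \<Gamma>"
    and f_C2: "Ck_on 2 f \<Gamma>"
    and f_concave: "concave_on \<Gamma> f"
    and f_sym: "\<And>p x. p permutes UNIV \<Longrightarrow> x \<in> \<Gamma> \<Longrightarrow> f (\<chi> i. x $ p i) = f x"
    and f_incr: "\<And>x j. x \<in> \<Gamma> \<Longrightarrow> partial j f x > 0"
    and f_c: "f (vec c) = 1"
    and \<gamma>\<^sub>0_nonneg: "0 \<le> \<gamma>\<^sub>0" and \<gamma>\<^sub>0_less: "\<gamma>\<^sub>0 < c"
    and level: "{\<gamma>. \<exists>\<beta>. bvec k \<beta> \<gamma> \<in> \<Gamma> \<and> f (bvec k \<beta> \<gamma>) = 1} = {\<gamma>\<^sub>0<..}"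
begin

section \<open>Monotonicity of the cone and of \<open>f\<close>\<close>

lemma \<Gamma>_add:
  assumes "x \<in> \<Gamma>" "y \<in> \<Gamma>"
  shows "x + y \<in> \<Gamma>"
proof -
  have "(1/2) *\<^sub>R x + (1/2) *\<^sub>R y \<in> \<Gamma>"
    using assms by (intro convexD[OF \<Gamma>_convex]) auto
  from \<Gamma>_cone[OF this, of 2] show ?thesis
    by (simp add: scaleR_add_right)
qed

text \<open>\<open>y\<close> may lie on the boundary of the positive orthant. Openness allows a
  small multiple of \<open>vec 1\<close> to be moved from \<open>x\<close> to \<open>y\<close>,
  after which both summands lie in \<Gamma>.\<close>

lemma \<Gamma>_add_nonneg:
  assumes "x \<in> \<Gamma>" "\<And>j. y $ j \<ge> 0"
  shows "x + y \<in> \<Gamma>"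
proof -
  obtain e where e: "e > 0" "ball x e \<subseteq> \<Gamma>"
    using \<Gamma>_open assms(1) open_contains_ball by blast
  define d where "d = e / (2 * (norm (vec 1 :: real^'n) + 1))"
  have pos: "norm (vec 1 :: real^'n) + 1 > 0"
    by (simp add: add_nonneg_pos)
  have "d > 0"
    using e pos by (simp add: d_def)
  have "d * norm (vec 1 :: real^'n) < d * (2 * (norm (vec 1 :: real^'n) + 1))"
    using \<open>d > 0\<close> by (intro mult_strict_left_mono) (auto simp: add_nonneg_pos)
  also have "\<dots> = e"
    using pos by (simp add: d_def)
  finally have "x - d *\<^sub>R vec 1 \<in> \<Gamma>"
    using e(2) \<open>d > 0\<close> by (auto simp: dist_norm)
  moreover have "y + d *\<^sub>R vec 1 \<in> \<Gamma>"
    using assms(2) \<open>d > 0\<close> by (intro \<Gamma>_pos) (simp add: add_nonneg_pos)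
  ultimately show ?thesis
    using \<Gamma>_add by fastforce
qed

lemma f_has_derivative:
  assumes "x \<in> \<Gamma>"
  shows "(f has_derivative (\<lambda>h. \<Sum>i\<in>UNIV. h $ i * partial i f x)) (at x)"
proof -
  define f' where "f' = frechet_derivative f (at x)"
  have "f differentiable (at x)"
    using f_C2 assms by (simp add: numeral_2_eq_2)
  then have f': "(f has_derivative f') (at x)"
    by (simp add: f'_def frechet_derivative_works)
  then interpret linear f'
    by (rule has_derivative_linear)
  have "f' h = (\<Sum>i\<in>UNIV. h $ i * partial i f x)" for h
  proof -
    have "h = (\<Sum>i\<in>UNIV. h $ i *\<^sub>R axis i 1)"
      by (simp add: vec_eq_iff axis_def if_distrib cong: if_cong)
    then have "f' h = (\<Sum>i\<in>UNIV. f' (h $ i *\<^sub>R axis i 1))"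
      by (metis sum)
    also have "\<dots> = (\<Sum>i\<in>UNIV. h $ i * partial i f x)"
      by (simp only: scale partial_def f'_def[symmetric] real_scaleR_def)
    finally show ?thesis .
  qed
  then show ?thesis
    using f' by presburger
qed

lemma f_line_derivative:
  assumes "x + s *\<^sub>R y \<in> \<Gamma>"
  shows "((\<lambda>s. f (x + s *\<^sub>R y)) has_real_derivative
    (\<Sum>i\<in>UNIV. y $ i * partial i f (x + s *\<^sub>R y))) (at s)"
proof -
  have "((\<lambda>s. x + s *\<^sub>R y) has_derivative (\<lambda>s. s *\<^sub>R y)) (at s)"
    by (auto intro!: derivative_eq_intros)
  from has_derivative_compose[OF this f_has_derivative[OF assms]]
  have "((\<lambda>s. f (x + s *\<^sub>R y)) has_derivative
      (\<lambda>t. \<Sum>i\<in>UNIV. t * y $ i * partial i f (x + s *\<^sub>R y))) (at s)"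
    by simp
  moreover have "(\<lambda>t. \<Sum>i\<in>UNIV. t * y $ i * partial i f (x + s *\<^sub>R y))
      = (*) (\<Sum>i\<in>UNIV. y $ i * partial i f (x + s *\<^sub>R y))"
    by (simp add: fun_eq_iff sum_distrib_left mult_ac)
  ultimately show ?thesis
    by (simp only: has_field_derivative_def)
qed

lemma f_strict_mono:
  assumes x: "x \<in> \<Gamma>" and y: "\<And>j. y $ j \<ge> 0" and i: "y $ i > 0"
  shows "f x < f (x + y)"
proof -
  have "f (x + 0 *\<^sub>R y) < f (x + 1 *\<^sub>R y)"
  proof (rule DERIV_pos_imp_increasing[where f = "\<lambda>s. f (x + s *\<^sub>R y)"])
    fix s :: real assume "0 \<le> s" "s \<le> 1"
    then have s: "x + s *\<^sub>R y \<in> \<Gamma>"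
      using x y by (intro \<Gamma>_add_nonneg) auto
    have "0 < (\<Sum>j\<in>UNIV. y $ j * partial j f (x + s *\<^sub>R y))"
      using f_incr[OF s] y i
      by (intro sum_pos2[of _ i]) (simp_all add: less_imp_le)
    then show "\<exists>D. ((\<lambda>s. f (x + s *\<^sub>R y)) has_real_derivative D) (at s) \<and> 0 < D"
      using f_line_derivative[OF s] by blast
  qed simp
  then show ?thesis
    by simp
qed

lemma f_bvec_less:
  assumes "bvec k \<beta> \<gamma> \<in> \<Gamma>" "\<beta> \<le> \<beta>'" "\<gamma> \<le> \<gamma>'" "(\<beta>, \<gamma>) \<noteq> (\<beta>', \<gamma>')"
  shows "bvec k \<beta>' \<gamma>' \<in> \<Gamma>" "f (bvec k \<beta> \<gamma>) < f (bvec k \<beta>' \<gamma>')"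
proof -
  define y :: "real^'n" where "y = bvec k (\<beta>' - \<beta>) (\<gamma>' - \<gamma>)"
  have eq: "bvec k \<beta>' \<gamma>' = bvec k \<beta> \<gamma> + y"
    by (simp add: y_def vec_eq_iff)
  have y: "y $ j \<ge> 0" for j
    using assms by (simp add: y_def)
  \<comment> \<open>If \<open>k\<close> were the only index, raising \<open>\<gamma>\<close> would
    leave the vector unchanged and strictness would fail.\<close>
  have "UNIV \<noteq> {k}"
  proof
    assume "UNIV = {k}"
    then have "CARD('n) = 1"
      by (metis card_1_singleton_iff One_nat_def)
    then show False
      using card by simp
  qed
  then obtain l where "l \<noteq> k"
    by blast
  moreover have "\<beta> < \<beta>' \<or> \<gamma> < \<gamma>'"
    using assms by auto
  ultimately obtain i where "y $ i > 0"
    unfolding y_def by (metis bvec_nth diff_gt_0_iff_gt)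
  then show "f (bvec k \<beta> \<gamma>) < f (bvec k \<beta>' \<gamma>')"
    unfolding eq using assms(1) y by (intro f_strict_mono)
  show "bvec k \<beta>' \<gamma>' \<in> \<Gamma>"
    unfolding eq using assms(1) y by (rule \<Gamma>_add_nonneg)
qed

section \<open>Monotonicity, convexity and supporting line of \<open>g\<close>\<close>

abbreviation G :: "real \<Rightarrow> real" where
  "G \<equiv> g k f \<Gamma>"

lemma level_unique:
  assumes "bvec k \<beta> \<gamma> \<in> \<Gamma>" "f (bvec k \<beta> \<gamma>) = 1" "bvec k \<beta>' \<gamma> \<in> \<Gamma>" "f (bvec k \<beta>' \<gamma>) = 1"
  shows "\<beta> = \<beta>'"
  using f_bvec_less(2)[of \<beta> \<gamma> \<beta>' \<gamma>] f_bvec_less(2)[of \<beta>' \<gamma> \<beta> \<gamma>] assms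
  by (cases \<beta> \<beta>' rule: linorder_cases) auto

lemma G_eqI:
  assumes "bvec k \<beta> \<gamma> \<in> \<Gamma>" "f (bvec k \<beta> \<gamma>) = 1"
  shows "G \<gamma> = \<beta>" "\<gamma> > \<gamma>\<^sub>0"
proof -
  show "G \<gamma> = \<beta>"
    unfolding g_def using assms level_unique by (intro the_equality) auto
  show "\<gamma> > \<gamma>\<^sub>0"
    using level assms by blast
qed

lemma G:
  assumes "\<gamma> > \<gamma>\<^sub>0"
  shows "bvec k (G \<gamma>) \<gamma> \<in> \<Gamma>" "f (bvec k (G \<gamma>) \<gamma>) = 1"
proof -
  obtain \<beta> where \<beta>: "bvec k \<beta> \<gamma> \<in> \<Gamma>" "f (bvec k \<beta> \<gamma>) = 1"
    using level assms by blast
  then show "bvec k (G \<gamma>) \<gamma> \<in> \<Gamma>" "f (bvec k (G \<gamma>) \<gamma>) = 1"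
    using G_eqI(1)[OF \<beta>] by auto
qed

text \<open>The means for all upper bounds on \<open>g\<close>: it suffices to exhibit a point of
  the superlevel set of \<open>f\<close> over \<open>\<gamma>\<close>.\<close>

lemma G_le:
  assumes "\<gamma> > \<gamma>\<^sub>0" "bvec k \<beta> \<gamma> \<in> \<Gamma>" "f (bvec k \<beta> \<gamma>) \<ge> 1"
  shows "G \<gamma> \<le> \<beta>"
  using f_bvec_less(2)[of \<beta> \<gamma> "G \<gamma>" \<gamma>] G[OF assms(1)] assms by fastforce

lemma c_pos: "c > 0"
  using \<gamma>\<^sub>0_nonneg \<gamma>\<^sub>0_less by simp

lemma vec_c: "vec c \<in> \<Gamma>"
  using c_pos by (intro \<Gamma>_pos) simp

lemma G_c: "G c = c"
  using G_eqI(1)[of c c] vec_c f_c by (simp add: bvec_diag)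

text \<open>Raising the repeated coordinate raises \<open>f\<close>, so the old first coordinate
  already reaches level 1.\<close>

lemma G_antimono:
  assumes "\<gamma>\<^sub>0 < x" "x \<le> y"
  shows "G y \<le> G x"
proof (cases "x = y")
  case False
  then have "bvec k (G x) y \<in> \<Gamma>" "f (bvec k (G x) x) < f (bvec k (G x) y)"
    using f_bvec_less[OF G(1)[OF assms(1)], of "G x" y] assms by auto
  then show ?thesis
    using G_le[of y "G x"] G(2)[OF assms(1)] assms by simp
qed simp

text \<open>By concavity of \<open>f\<close> the set of points of \<Gamma> with
  \<open>f \<ge> 1\<close> is convex, and a convex combination of two points on the graph of
  \<open>G\<close> stays in it.\<close>

lemma G_convex: "convex_on {\<gamma>\<^sub>0<..} G"
proof (rule convex_onI)
  fix t x y :: real assume t: "0 < t" "t < 1" and xy: "x \<in> {\<gamma>\<^sub>0<..}" "y \<in> {\<gamma>\<^sub>0<..}"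
  let ?z = "(1 - t) *\<^sub>R x + t *\<^sub>R y"
  have z: "?z \<in> {\<gamma>\<^sub>0<..}"
    using t xy by (intro convexD) auto
  have eq: "bvec k ((1 - t) * G x + t * G y) ?z
      = (1 - t) *\<^sub>R bvec k (G x) x + t *\<^sub>R bvec k (G y) y"
    by (simp add: vec_eq_iff)
  have "bvec k ((1 - t) * G x + t * G y) ?z \<in> \<Gamma>"
    unfolding eq using t xy G by (intro convexD[OF \<Gamma>_convex]) auto
  moreover have "(1 - t) * f (bvec k (G x) x) + t * f (bvec k (G y) y)
      \<le> f (bvec k ((1 - t) * G x + t * G y) ?z)"
    unfolding eq using t xy G by (intro concave_onD[OF f_concave]) auto
  then have "f (bvec k ((1 - t) * G x + t * G y) ?z) \<ge> 1"
    using xy G by simp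
  ultimately show "G ?z \<le> (1 - t) * G x + t * G y"
    using z by (intro G_le) auto
qed simp

lemma bvec_swap:
  assumes "bvec k \<beta> \<gamma> \<in> \<Gamma>"
  shows "bvec j \<beta> \<gamma> \<in> \<Gamma>" "f (bvec j \<beta> \<gamma>) = f (bvec k \<beta> \<gamma>)"
proof -
  have p: "Transposition.transpose j k permutes UNIV"
    by (rule permutes_swap_id) auto
  have "bvec j \<beta> \<gamma> = (\<chi> i. bvec k \<beta> \<gamma> $ Transposition.transpose j k i)"
    by (auto simp: vec_eq_iff Transposition.transpose_def)
  then show "bvec j \<beta> \<gamma> \<in> \<Gamma>" "f (bvec j \<beta> \<gamma>) = f (bvec k \<beta> \<gamma>)"
    using \<Gamma>_sym[OF p assms] f_sym[OF p assms] by simp_all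
qed

text \<open>Averaging \<open>(G x, x, \<dots>, x)\<close> over its permutations does not decrease \<open>f\<close>, by concavity.\<close>

lemma G_tangent:
  assumes "\<gamma>\<^sub>0 < x"
  shows "c - (real CARD('n) - 1) * (x - c) \<le> G x"
proof -
  let ?N = "real CARD('n)"
  define a where "a = (G x + (?N - 1) * x) / ?N"
  have N: "?N \<ge> 3"
    using card by simp
  have sum: "(\<Sum>j\<in>(UNIV :: 'n set). (1 / ?N) *\<^sub>R bvec j (G x) x) = vec a"
  proof -
    have "(\<Sum>j\<in>UNIV. bvec j (G x) x $ i) = G x + (?N - 1) * x" for i :: 'n
    proof -
      have "(\<Sum>j\<in>UNIV. bvec j (G x) x $ i) = (\<Sum>j\<in>UNIV. (if i = j then G x - x else 0) + x)"
        by (intro sum.cong) auto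
      then show ?thesis
        by (simp add: sum.distrib algebra_simps)
    qed
    then have "(\<Sum>j\<in>UNIV. (1 / ?N) *\<^sub>R bvec j (G x) x) $ i = vec a $ i" for i :: 'n
      by (simp only: sum_component vector_scaleR_component sum_distrib_left[symmetric]
          vec_component a_def real_scaleR_def) simp
    then show ?thesis
      by (simp add: vec_eq_iff)
  qed
  have mem: "bvec j (G x) x \<in> \<Gamma>" "f (bvec j (G x) x) = 1" for j
    using bvec_swap[OF G(1)[OF assms]] G(2)[OF assms] by auto
  have "- f (\<Sum>j\<in>UNIV. (1 / ?N) *\<^sub>R bvec j (G x) x) \<le> (\<Sum>j\<in>UNIV. (1 / ?N) * (- f (bvec j (G x) x)))"
    by (rule convex_on_sum[of UNIV \<Gamma> "\<lambda>x. - f x"])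
      (use f_concave mem in \<open>auto simp: concave_on_def\<close>)
  then have "f (vec a) \<ge> 1"
    unfolding sum using mem by simp
  moreover have "vec a \<in> \<Gamma>"
    unfolding sum[symmetric] using mem by (intro convex_sum \<Gamma>_convex) auto
  \<comment> \<open>\<open>f\<close> is strictly increasing along the diagonal and equals 1 at
    \<open>vec c\<close>.\<close>
  ultimately have "a \<ge> c"
    using f_bvec_less(2)[of a a c c] f_c by (auto simp: bvec_diag intro: leI)
  then show ?thesis
    using N by (simp add: a_def field_simps)
qed

section \<open>Second-order upper bound for \<open>g\<close> at the fixed point\<close>

text \<open>A transposition fixes \<open>vec c\<close> and exchanges the lines through it in
  directions \<open>j\<close> and \<open>k\<close>, on which \<open>f\<close> therefore
  agrees.\<close>

lemma partial_f_vec_c: "partial j f (vec c) = partial k f (vec c)"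
proof -
  have line: "vec c + s *\<^sub>R axis j 1 = bvec j (c + s) c" for s and j :: 'n
    by (auto simp: vec_eq_iff axis_def)
  have deriv: "((\<lambda>s. f (bvec j (c + s) c)) has_real_derivative partial j f (vec c)) (at 0)" for j
  proof -
    have "(\<Sum>i\<in>UNIV. axis j 1 $ i * partial i f (vec c)) = partial j f (vec c)"
      by (simp add: axis_def if_distrib[of "\<lambda>z. z * _"] cong: if_cong)
    then show ?thesis
      using f_line_derivative[of "vec c" 0 "axis j 1"] vec_c unfolding line by (simp add: bvec_diag)
  qed
  \<comment> \<open>For \<open>\<bar>s\<bar> < c\<close> the point stays in the positive orthant,
    hence in \<Gamma>, where symmetry may be used.\<close>
  have eq: "f (bvec j (c + s) c) = f (bvec k (c + s) c)" if "dist s 0 < c" for s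
    using that c_pos by (intro bvec_swap(2) \<Gamma>_pos) (simp add: abs_less_iff)
  have "((\<lambda>s. f (bvec k (c + s) c)) has_real_derivative partial j f (vec c)) (at 0)"
    by (rule has_field_derivative_transform_within[OF deriv[of j] c_pos]) (simp_all add: eq)
  then show ?thesis
    by (rule DERIV_unique) (rule deriv)
qed

text \<open>Differentiability of the partial derivatives at this one point is enough: the
  first-order remainder is taken with tolerance 1, giving the constant \<open>1 + B\<close>. Summing
  the constants and taking the least radius makes the bound uniform in the direction.\<close>

lemma partial_f_lipschitz_at_c:
  obtains L d where "L \<ge> 0" "d > 0"
    "\<And>j v. norm v < d \<Longrightarrow> \<bar>partial j f (vec c + v) - partial k f (vec c)\<bar> \<le> L * norm v"
proof -
  define P where "P j L d \<longleftrightarrow> L \<ge> 0 \<and> d > 0 \<and>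
      (\<forall>v. norm v < d \<longrightarrow> \<bar>partial j f (vec c + v) - partial k f (vec c)\<bar> \<le> L * norm v)" for j L d
  have "\<exists>L d. P j L d" for j
  proof -
    have "partial j f differentiable (at (vec c))"
      using f_C2 vec_c by (simp add: numeral_2_eq_2)
    then obtain D where D: "(partial j f has_derivative D) (at (vec c))"
      by (auto simp: differentiable_def)
    obtain B where B: "\<And>v. norm (D v) \<le> norm v * B" "0 < B"
      using bounded_linear.pos_bounded[OF has_derivative_bounded_linear[OF D]] by blast
    have "\<exists>d>0. \<forall>y. norm (y - vec c) < d \<longrightarrow>
        norm (partial j f y - partial j f (vec c) - D (y - vec c)) \<le> 1 * norm (y - vec c)"
      using D zero_less_one unfolding has_derivative_at_alt by blast
    then obtain d where d: "d > 0" "\<And>y. norm (y - vec c) < d \<Longrightarrow>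
        norm (partial j f y - partial j f (vec c) - D (y - vec c)) \<le> 1 * norm (y - vec c)"
      by blast
    have "\<bar>partial j f (vec c + v) - partial k f (vec c)\<bar> \<le> (1 + B) * norm v"
      if "norm v < d" for v :: "real^'n"
    proof -
      have "\<bar>partial j f (vec c + v) - partial k f (vec c) - D v\<bar> \<le> norm v"
        using d(2)[of "vec c + v"] that partial_f_vec_c[of j] by simp
      moreover have "\<bar>D v\<bar> \<le> norm v * B"
        using B(1)[of v] by simp
      moreover have "(1 + B) * norm v = norm v + norm v * B"
        by (simp add: algebra_simps)
      ultimately show ?thesis
        by linarith
    qed
    then have "P j (1 + B) d"
      using B(2) d(1) unfolding P_def by simp
    then show ?thesis
      by blast
  qed
  then obtain L d where "\<And>j. P j (L j) (d j)"
    by metis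
  then have Ld: "\<And>j. L j \<ge> 0" "\<And>j. d j > 0"
    "\<And>j v. norm v < d j \<Longrightarrow> \<bar>partial j f (vec c + v) - partial k f (vec c)\<bar> \<le> L j * norm v"
    unfolding P_def by blast+
  show thesis
  proof (rule that[of "\<Sum>j\<in>UNIV. L j" "Min (range d)"])
    show "0 \<le> (\<Sum>j\<in>UNIV. L j)"
      using Ld by (intro sum_nonneg) auto
    show "0 < Min (range d)"
      using Ld by (simp add: Min_gr_iff)
    fix j and v :: "real^'n" assume "norm v < Min (range d)"
    then have "norm v < d j"
      by simp
    then have "\<bar>partial j f (vec c + v) - partial k f (vec c)\<bar> \<le> L j * norm v"
      by (rule Ld)
    also have "\<dots> \<le> (\<Sum>j\<in>UNIV. L j) * norm v"
      using Ld by (intro mult_right_mono member_le_sum) auto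
    finally show "\<bar>partial j f (vec c + v) - partial k f (vec c)\<bar> \<le> (\<Sum>j\<in>UNIV. L j) * norm v" .
  qed
qed

text \<open>Stands in for a second-order Taylor estimate: the mean value theorem along the segment,
  with each partial derivative replaced by the common value at \<open>vec c\<close>.\<close>

lemma f_lower_near_c:
  obtains L d where "L \<ge> 0" "d > 0"
    "\<And>v. norm v < d \<Longrightarrow> vec c + v \<in> \<Gamma> \<and>
      1 + partial k f (vec c) * (\<Sum>i\<in>UNIV. v $ i) - L * norm v * (\<Sum>i\<in>UNIV. \<bar>v $ i\<bar>) \<le> f (vec c + v)"
proof -
  let ?A = "partial k f (vec c)"
  obtain L d where Ld: "L \<ge> 0" "d > 0"
    "\<And>j v. norm v < d \<Longrightarrow> \<bar>partial j f (vec c + v) - ?A\<bar> \<le> L * norm v"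
    using partial_f_lipschitz_at_c by metis
  have mem: "vec c + v \<in> \<Gamma>" if "norm v < c" for v :: "real^'n"
  proof (rule \<Gamma>_pos)
    show "0 < (vec c + v) $ j" for j
      using component_le_norm_cart[of v j] that by (simp add: abs_le_iff)
  qed
  have "1 + ?A * (\<Sum>i\<in>UNIV. v $ i) - L * norm v * (\<Sum>i\<in>UNIV. \<bar>v $ i\<bar>) \<le> f (vec c + v)"
    if v: "norm v < min d c" for v :: "real^'n"
  proof -
    have le: "norm (s *\<^sub>R v) \<le> norm v" if "0 \<le> s" "s \<le> 1" for s
      using that by (simp add: mult_left_le_one_le)
    have "((\<lambda>s. f (vec c + s *\<^sub>R v)) has_real_derivative
        (\<Sum>i\<in>UNIV. v $ i * partial i f (vec c + s *\<^sub>R v))) (at s)" if "0 \<le> s" "s \<le> 1" for s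
      using le[OF that] v by (intro f_line_derivative mem) linarith
    from MVT2[of 0 1, OF _ this] obtain s where s: "0 < s" "s < 1"
      "f (vec c + 1 *\<^sub>R v) - f (vec c + 0 *\<^sub>R v)
        = (1 - 0) * (\<Sum>i\<in>UNIV. v $ i * partial i f (vec c + s *\<^sub>R v))"
      by (auto simp: zero_less_one)
    have "v $ i * ?A - L * norm v * \<bar>v $ i\<bar> \<le> v $ i * partial i f (vec c + s *\<^sub>R v)" for i
    proof -
      have "\<bar>partial i f (vec c + s *\<^sub>R v) - ?A\<bar> \<le> L * norm (s *\<^sub>R v)"
        using le[of s] s v by (intro Ld) linarith
      also have "\<dots> \<le> L * norm v"
        using le[of s] s Ld by (intro mult_left_mono) auto
      finally have "\<bar>v $ i * (partial i f (vec c + s *\<^sub>R v) - ?A)\<bar> \<le> \<bar>v $ i\<bar> * (L * norm v)"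
        unfolding abs_mult by (intro mult_left_mono) auto
      then show ?thesis
        by (simp add: abs_le_iff algebra_simps)
    qed
    then have "(\<Sum>i\<in>UNIV. v $ i * ?A - L * norm v * \<bar>v $ i\<bar>)
        \<le> (\<Sum>i\<in>UNIV. v $ i * partial i f (vec c + s *\<^sub>R v))"
      by (intro sum_mono)
    then show ?thesis
      using s(3) f_c by (simp add: sum_subtractf sum_distrib_left sum_distrib_right mult.commute)
  qed
  then show thesis
    using that[of L "min d c"] Ld mem c_pos by auto
qed

text \<open>The trial value \<open>c - M * y + K * y\<^sup>2\<close> is tested with
  \<open>G_le\<close>. The first-order terms cancel because all partial derivatives at
  \<open>vec c\<close> coincide, so the displacement sums to \<open>K * y\<^sup>2\<close>; its
  contribution to \<open>f\<close> must outweigh the quadratic remainder.\<close>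

lemma G_upper_near_c:
  obtains K \<delta> where "K \<ge> 0" "\<delta> > 0"
    "\<And>y. 0 < y \<Longrightarrow> y < \<delta> \<Longrightarrow> G (c + y) \<le> c - (real CARD('n) - 1) * y + K * y\<^sup>2"
proof -
  let ?A = "partial k f (vec c)"
  define M where "M = real CARD('n) - 1"
  have M: "M \<ge> 2"
    using card by (simp add: M_def)
  have A: "?A > 0"
    using f_incr vec_c by blast
  obtain L d where L: "L \<ge> 0" and d: "d > 0" and Ld:
    "\<And>v. norm v < d \<Longrightarrow> vec c + v \<in> \<Gamma> \<and>
      1 + ?A * (\<Sum>i\<in>UNIV. v $ i) - L * norm v * (\<Sum>i\<in>UNIV. \<bar>v $ i\<bar>) \<le> f (vec c + v)"
    using f_lower_near_c by metis
  \<comment> \<open>Balances the gain \<open>?A * (K * y\<^sup>2)\<close> against the remainder, at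
    most \<open>L * (2 * M * y)\<^sup>2\<close>.\<close>
  define K where "K = L * (2 * M)\<^sup>2 / ?A"
  have K: "K \<ge> 0"
    using L A by (simp add: K_def)
  \<comment> \<open>The first term keeps the displacement shorter than \<open>d\<close>. The second
    forces \<open>K * y \<le> M\<close>, so the quadratic correction does not enlarge slot
    \<open>k\<close> beyond \<open>M * y\<close> in absolute value.\<close>
  define \<delta> where "\<delta> = min (d / (2 * M)) (1 / (K + 1))"
  have "\<delta> > 0"
    using d M K by (simp add: \<delta>_def)
  moreover have "G (c + y) \<le> c - M * y + K * y\<^sup>2" if y: "0 < y" "y < \<delta>" for y
  proof -
    define v :: "real^'n" where "v = bvec k (- M * y + K * y\<^sup>2) y"
    have sum_bvec: "(\<Sum>i\<in>UNIV. h (bvec k \<beta> \<gamma> $ i)) = h \<beta> + M * h \<gamma>" for h :: "real \<Rightarrow> real" and \<beta> \<gamma>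
    proof -
      have "(\<Sum>i\<in>UNIV. h (bvec k \<beta> \<gamma> $ i)) = (\<Sum>i\<in>UNIV. (if i = k then h \<beta> - h \<gamma> else 0) + h \<gamma>)"
        by (intro sum.cong) auto
      then show ?thesis
        by (simp add: sum.distrib M_def algebra_simps)
    qed
    have "y * (K + 1) < 1"
      using y(2) K by (simp add: \<delta>_def field_simps)
    then have "K * y \<le> M"
      using y(1) M by (simp add: algebra_simps)
    then have Ky: "K * y * y \<le> M * y" "0 \<le> K * y * y"
      using y(1) K by (auto intro: mult_right_mono)
    have sum_abs: "(\<Sum>i\<in>UNIV. \<bar>v $ i\<bar>) \<le> 2 * M * y"
      unfolding v_def using sum_bvec[of abs] Ky y(1) by (simp add: power2_eq_square abs_le_iff)
    have norm_v: "norm v \<le> 2 * M * y"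
      using norm_le_l1_cart[of v] sum_abs by linarith
    also have "\<dots> < d"
      using y(2) M by (simp add: \<delta>_def field_simps)
    finally have v: "vec c + v \<in> \<Gamma>"
      "1 + ?A * (\<Sum>i\<in>UNIV. v $ i) - L * norm v * (\<Sum>i\<in>UNIV. \<bar>v $ i\<bar>) \<le> f (vec c + v)"
      using Ld by auto
    have "L * norm v * (\<Sum>i\<in>UNIV. \<bar>v $ i\<bar>) \<le> L * (2 * M * y) * (2 * M * y)"
      using norm_v sum_abs L M y(1) by (intro mult_mono) (auto intro: sum_nonneg)
    also have "\<dots> = ?A * (K * y\<^sup>2)"
      using A by (simp add: K_def power2_eq_square)
    also have "K * y\<^sup>2 = (\<Sum>i\<in>UNIV. v $ i)"
      unfolding v_def using sum_bvec[of "\<lambda>x. x"] by simp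
    finally have "f (vec c + v) \<ge> 1"
      using v(2) by linarith
    moreover have "vec c + v = bvec k (c - M * y + K * y\<^sup>2) (c + y)"
      by (simp add: v_def vec_eq_iff)
    ultimately show ?thesis
      using v(1) y(1) \<gamma>\<^sub>0_less by (intro G_le) auto
  qed
  ultimately show thesis
    using that[of K \<delta>] K unfolding M_def by blast
qed

text \<open>The quadratic bound is known only within \<open>\<delta>\<close> of \<open>c\<close>.
  Farther out \<open>G x \<le> c\<close>, and enlarging \<open>K\<close> by
  \<open>?M / \<delta>\<close> compensates the whole linear term.\<close>

lemma radial_flow_G: "\<exists>K. radial_flow G \<gamma>\<^sub>0 c K CARD('n)"
proof -
  let ?M = "real CARD('n) - 1"
  obtain K \<delta> where K: "K \<ge> 0" "\<delta> > 0"
    "\<And>y. 0 < y \<Longrightarrow> y < \<delta> \<Longrightarrow> G (c + y) \<le> c - ?M * y + K * y\<^sup>2"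
    using G_upper_near_c by metis
  have M: "?M \<ge> 0"
    using card by simp
  have "G x \<le> c - ?M * (x - c) + (K + ?M / \<delta>) * (x - c)\<^sup>2" if "c < x" for x
  proof (cases "x - c < \<delta>")
    case True
    have "0 \<le> ?M / \<delta> * (x - c)\<^sup>2"
      using K M by simp
    moreover have "G x \<le> c - ?M * (x - c) + K * (x - c)\<^sup>2"
      using K(3)[of "x - c"] True that by simp
    ultimately show ?thesis
      unfolding distrib_right by linarith
  next
    case False
    then have "?M * \<delta> \<le> ?M * (x - c)"
      using M by (intro mult_left_mono) auto
    then have "?M \<le> ?M / \<delta> * (x - c)"
      using K by (simp add: field_simps)
    then have "?M * (x - c) \<le> ?M / \<delta> * (x - c) * (x - c)"
      using that by (intro mult_right_mono) auto
    moreover have "0 \<le> K * (x - c)\<^sup>2"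
      using K by simp
    ultimately show ?thesis
      using G_antimono[of c x] G_c \<gamma>\<^sub>0_less that by (simp add: distrib_right power2_eq_square mult.assoc)
  qed
  then have "radial_flow G \<gamma>\<^sub>0 c (K + ?M / \<delta>) CARD('n)"
    using K M card \<gamma>\<^sub>0_less G_convex G_antimono G_c G_tangent by unfold_locales auto
  then show ?thesis
    by blast
qed

end

section \<open>Radial solutions\<close>

context hessian_operator
begin

text \<open>Fixes one witness, since the interpretation below needs a term and not an existential
  statement.\<close>

definition flow_const :: real where
  "flow_const = (SOME K. radial_flow G \<gamma>\<^sub>0 c K CARD('n))"

sublocale flow: radial_flow G \<gamma>\<^sub>0 c flow_const "CARD('n)"
  unfolding flow_const_def using radial_flow_G by (rule someI_ex)

definition radial_solution :: "real \<Rightarrow> real \<Rightarrow> real^'n \<Rightarrow> real" where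
  "radial_solution b \<alpha> =
     restrict (\<lambda>x. b + integral {1..norm x} (\<lambda>s. s * W G \<gamma>\<^sub>0 s \<alpha>)) (- ball 0 1)"

text \<open>Undoes the unknown ordering of the eigenvalues and turns admissibility together with the
  equation into a relation for \<open>g\<close>.\<close>

lemma admissible_iff:
  assumes p: "p permutes UNIV"
  shows "(\<chi> i. bvec k \<beta> \<gamma> $ p i) \<in> \<Gamma> \<and> f (\<chi> i. bvec k \<beta> \<gamma> $ p i) = 1
    \<longleftrightarrow> \<gamma> > \<gamma>\<^sub>0 \<and> \<beta> = G \<gamma>" (is "?l \<longleftrightarrow> ?r")
proof
  assume l: ?l
  have "(\<chi> i. (\<chi> i. bvec k \<beta> \<gamma> $ p i) $ inv p i) = bvec k \<beta> \<gamma>"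
    using p by (simp add: vec_eq_iff permutes_inverses)
  then have "bvec k \<beta> \<gamma> \<in> \<Gamma>"
    using \<Gamma>_sym[OF permutes_inv[OF p], of "\<chi> i. bvec k \<beta> \<gamma> $ p i"] l by simp
  moreover from f_sym[OF p this] have "f (bvec k \<beta> \<gamma>) = 1"
    using l by simp
  ultimately show ?r
    using G_eqI[of \<beta> \<gamma>] by simp
next
  assume ?r
  then have bvec: "bvec k \<beta> \<gamma> \<in> \<Gamma>" "f (bvec k \<beta> \<gamma>) = 1"
    using G[of \<gamma>] by simp_all
  show ?l
    using \<Gamma>_sym[OF p bvec(1)] f_sym[OF p bvec(1)] bvec(2) by simp
qed

section \<open>From initial values to solutions\<close>

context
  fixes b \<alpha> :: real
  assumes \<alpha>: "\<alpha> \<ge> \<gamma>\<^sub>0"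
begin

lemma integrand_cont: "continuous_on {1..} (\<lambda>s. s * W G \<gamma>\<^sub>0 s \<alpha>)"
  by (intro continuous_intros flow.W_solutionD(1)[OF flow.W_solution_W[OF \<alpha>]])

text \<open>Includes the one-sided derivative at \<open>r = 1\<close>, as regularity up to the
  sphere requires.\<close>

lemma potential_deriv_within:
  assumes "r \<ge> 1"
  shows "((\<lambda>r. b + integral {1..r} (\<lambda>s. s * W G \<gamma>\<^sub>0 s \<alpha>)) has_real_derivative r * W G \<gamma>\<^sub>0 r \<alpha>)
    (at r within {1..})"
proof -
  have "((\<lambda>r. integral {1..r} (\<lambda>s. s * W G \<gamma>\<^sub>0 s \<alpha>)) has_real_derivative r * W G \<gamma>\<^sub>0 r \<alpha>)
      (at r within {1..r + 1})"
    using assms continuous_on_subset[OF integrand_cont] by (intro integral_has_real_derivative) auto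
  moreover have "at r within {1..r + 1} = at r within {1..}"
    by (rule at_within_nhd[of r "{..<r + 1}"]) auto
  ultimately show ?thesis
    by (auto intro!: derivative_eq_intros)
qed

lemma potential_deriv:
  assumes "r > 1"
  shows "((\<lambda>r. b + integral {1..r} (\<lambda>s. s * W G \<gamma>\<^sub>0 s \<alpha>)) has_real_derivative r * W G \<gamma>\<^sub>0 r \<alpha>) (at r)"
proof -
  have "at r within {1..} = at r"
    using assms by (intro at_within_interior) simp
  then show ?thesis
    using potential_deriv_within[of r] assms by simp
qed

lemma radial_solution_eq:
  "norm x \<ge> 1 \<Longrightarrow> radial_solution b \<alpha> x = b + integral {1..norm x} (\<lambda>s. s * W G \<gamma>\<^sub>0 s \<alpha>)"
  by (simp add: radial_solution_def)

lemma radial_solution_sphere: "x \<in> sphere 0 1 \<Longrightarrow> radial_solution b \<alpha> x = b"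
  by (simp add: radial_solution_eq)

text \<open>The gradient is \<open>W\<close> at the norm, times \<open>x\<close>; its continuity up
  to the sphere needs only continuity of \<open>W\<close> at 1, so the threshold value
  \<open>\<gamma>\<^sub>0\<close> is covered.\<close>

lemma radial_solution_C1: "C1_up_to_boundary (radial_solution b \<alpha>) (- ball 0 1)"
  unfolding C1_up_to_boundary_def
proof (intro exI conjI ballI)
  show "continuous_on (- ball 0 1) (\<lambda>x :: real^'n. W G \<gamma>\<^sub>0 (norm x) \<alpha> *\<^sub>R x)"
    by (intro continuous_intros
        continuous_on_compose2[OF flow.W_solutionD(1)[OF flow.W_solution_W[OF \<alpha>]]]) auto
  fix x :: "real^'n" assume x: "x \<in> - ball 0 1"
  then have "x \<noteq> 0"
    by auto
  have "((\<lambda>x :: real^'n. b + integral {1..norm x} (\<lambda>s. s * W G \<gamma>\<^sub>0 s \<alpha>)) has_derivative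
      (\<lambda>h. (norm x * W G \<gamma>\<^sub>0 (norm x) \<alpha>) * (h \<bullet> sgn x))) (at x within - ball 0 1)"
    by (rule has_derivative_in_compose2[where t = "{1..}" and f = norm
          and g' = "\<lambda>r. (*) (r * W G \<gamma>\<^sub>0 r \<alpha>)"])
      (use x potential_deriv_within has_derivative_norm[OF \<open>x \<noteq> 0\<close>]
        in \<open>auto simp: has_field_derivative_def intro: has_derivative_at_withinI\<close>)
  moreover have "(\<lambda>h. (norm x * W G \<gamma>\<^sub>0 (norm x) \<alpha>) * (h \<bullet> sgn x))
      = (\<lambda>h. (W G \<gamma>\<^sub>0 (norm x) \<alpha> *\<^sub>R x) \<bullet> h)"
    using \<open>x \<noteq> 0\<close> by (simp add: fun_eq_iff sgn_div_norm inner_commute[of _ x])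
  ultimately show "(radial_solution b \<alpha> has_derivative
      (\<lambda>h. (W G \<gamma>\<^sub>0 (norm x) \<alpha> *\<^sub>R x) \<bullet> h)) (at x within - ball 0 1)"
    using x by (intro has_derivative_transform[OF x, of "radial_solution b \<alpha>"
        "\<lambda>x. b + integral {1..norm x} (\<lambda>s. s * W G \<gamma>\<^sub>0 s \<alpha>)"]) (simp_all add: radial_solution_eq)
qed

lemma radial_solution_\<Phi>: "radial_solution b \<alpha> \<in> \<Phi> \<Gamma>"
  and radial_solution_equation: "x \<in> - cball 0 1 \<Longrightarrow> f (eigvals (hessian (radial_solution b \<alpha>) x)) = 1"
proof -
  let ?w = "\<lambda>r. W G \<gamma>\<^sub>0 r \<alpha>" and ?w' = "\<lambda>r. (G (W G \<gamma>\<^sub>0 r \<alpha>) - W G \<gamma>\<^sub>0 r \<alpha>) / r"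
  note w = flow.W_solutionD[OF flow.W_solution_W[OF \<alpha>]]
  have u: "radial_solution b \<alpha> x = b + integral {1..norm x} (\<lambda>s. s * ?w s)"
    if "norm x > 1" for x
    using that by (simp add: radial_solution_eq)
  have w_cont: "continuous_on {1<..} ?w"
    using w(1) by (rule continuous_on_subset) auto
  have "continuous_on {1<..} (\<lambda>r. G (?w r))"
    by (rule continuous_on_compose2[OF flow.G_cont w_cont]) (use w(3) in auto)
  then have "continuous_on {1<..} ?w'"
    using w_cont by (intro continuous_intros) auto
  then have C2: "Ck_on 2 (radial_solution b \<alpha>) (- cball 0 1)"
    using radial_Ck_on_2[OF u potential_deriv w(4)] by blast
  have eq: "eigvals (hessian (radial_solution b \<alpha>) x) \<in> \<Gamma> \<and>
      f (eigvals (hessian (radial_solution b \<alpha>) x)) = 1" if x: "norm x > 1" for x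
  proof -
    obtain p where p: "p permutes UNIV" "eigvals (hessian (radial_solution b \<alpha>) x) =
        (\<chi> i. bvec k (?w (norm x) + norm x * ?w' (norm x)) (?w (norm x)) $ p i)"
      by (rule radial_eigvals[OF u potential_deriv w(4) x])
    have "norm x \<noteq> 0"
      using x by linarith
    \<comment> \<open>The differential equation says precisely that the radial eigenvalue is
      \<open>g\<close> of the tangential one.\<close>
    then have "?w (norm x) + norm x * ?w' (norm x) = G (?w (norm x))"
      by simp
    then show ?thesis
      unfolding p(2) by (rule admissible_iff[OF p(1), THEN iffD2, OF conjI[OF w(3)[OF x]]])
  qed
  then show "f (eigvals (hessian (radial_solution b \<alpha>) x)) = 1" if "x \<in> - cball 0 1"
    using that by simp
  have "radial_solution b \<alpha> \<in> extensional (- ball 0 1)"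
    by (simp add: radial_solution_def)
  moreover have "radial_solution b \<alpha> x = radial_solution b \<alpha> y"
    if "norm x \<ge> 1 \<and> norm x = norm y" for x y
    using that radial_solution_eq[of x] radial_solution_eq[of y] by simp
  moreover have "admissible_on \<Gamma> (radial_solution b \<alpha>) (- cball 0 1)"
    using eq by (simp add: admissible_on_def)
  ultimately show "radial_solution b \<alpha> \<in> \<Phi> \<Gamma>"
    unfolding \<Phi>_def using C2 radial_solution_C1 by blast
qed

text \<open>The integrand splits into \<open>s * c\<close> and the excess. The first integrates to
  the quadratic term, its lower limit 1 producing \<open>- c / 2\<close>; the second is \<mu> up to
  its tail.\<close>

lemma radial_solution_asymptotics:
  "(\<lambda>x. radial_solution b \<alpha> x - (c / 2 * (norm x)\<^sup>2 + (\<mu> G \<gamma>\<^sub>0 c \<alpha> + b - c / 2)))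
     \<in> O[at_infinity](\<lambda>x. norm x powr (2 - real CARD('n)))"
proof (rule bigoI, rule eventually_at_infinityI)
  fix x :: "real^'n" assume x: "1 \<le> norm x"
  let ?R = "norm x"
  have "((\<lambda>s. s * c) has_integral (c / 2 * ?R\<^sup>2 - c / 2 * 1\<^sup>2)) {1..?R}"
    using x by (intro fundamental_theorem_of_calculus)
      (auto intro!: derivative_eq_intros simp flip: has_real_derivative_iff_has_vector_derivative)
  moreover have "(flow.excess \<alpha> has_integral integral {1..?R} (flow.excess \<alpha>)) {1..?R}"
    by (intro integrable_integral integrable_continuous_real
        continuous_on_subset[OF flow.excess_cont[OF \<alpha>]]) auto
  ultimately have "((\<lambda>s. s * c + flow.excess \<alpha> s) has_integral
      (c / 2 * ?R\<^sup>2 - c / 2 * 1\<^sup>2) + integral {1..?R} (flow.excess \<alpha>)) {1..?R}"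
    by (rule has_integral_add)
  moreover have "(\<lambda>s. s * c + flow.excess \<alpha> s) = (\<lambda>s. s * W G \<gamma>\<^sub>0 s \<alpha>)"
    by (simp add: fun_eq_iff algebra_simps)
  ultimately have "integral {1..?R} (\<lambda>s. s * W G \<gamma>\<^sub>0 s \<alpha>)
      = c / 2 * ?R\<^sup>2 - c / 2 + integral {1..?R} (flow.excess \<alpha>)"
    by (simp add: integral_unique)
  then have "norm (radial_solution b \<alpha> x - (c / 2 * ?R\<^sup>2 + (\<mu> G \<gamma>\<^sub>0 c \<alpha> + b - c / 2)))
      = \<bar>integral {1..?R} (flow.excess \<alpha>) - \<mu> G \<gamma>\<^sub>0 c \<alpha>\<bar>"
    using x by (simp add: radial_solution_eq)
  also have "\<dots> \<le> flow.decay_const \<alpha> / ?R ^ (CARD('n) - 2)"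
    by (rule flow.\<mu>_partial[OF \<alpha> x])
  also have "1 / ?R ^ (CARD('n) - 2) = ?R powr (2 - real CARD('n))"
  proof -
    have "?R powr (2 - real CARD('n)) = ?R powr - real (CARD('n) - 2)"
      using card by simp
    also have "\<dots> = 1 / ?R ^ (CARD('n) - 2)"
      using x by (simp only: powr_minus powr_realpow inverse_eq_divide)
    finally show ?thesis
      by simp
  qed
  then have "flow.decay_const \<alpha> / ?R ^ (CARD('n) - 2)
      = flow.decay_const \<alpha> * norm (?R powr (2 - real CARD('n)))"
    by (simp add: divide_inverse)
  finally show "norm (radial_solution b \<alpha> x - (c / 2 * ?R\<^sup>2 + (\<mu> G \<gamma>\<^sub>0 c \<alpha> + b - c / 2)))
      \<le> flow.decay_const \<alpha> * norm (?R powr (2 - real CARD('n)))" .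
qed

text \<open>Two expansions of the same function differ by a constant that is O(|x|^(2-n)). As n >= 3
  this bound tends to 0, so the constant vanishes.\<close>

lemma radial_solution_asymptotics_iff:
  "(\<lambda>x. radial_solution b \<alpha> x - (c / 2 * (norm x)\<^sup>2 + d))
     \<in> O[at_infinity](\<lambda>x. norm x powr (2 - real CARD('n)))
    \<longleftrightarrow> d = \<mu> G \<gamma>\<^sub>0 c \<alpha> + b - c / 2" (is "?l \<longleftrightarrow> d = ?d")
proof
  assume ?l
  from sum_in_bigo(2)[OF this radial_solution_asymptotics]
  have "(\<lambda>_ :: real^'n. ?d - d) \<in> O[at_infinity](\<lambda>x. norm x powr (2 - real CARD('n)))"
    by (simp add: algebra_simps)
  then obtain C where C: "\<forall>\<^sub>F x :: real^'n in at_infinity.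
      norm (?d - d) \<le> C * norm (norm x powr (2 - real CARD('n)))"
    by (elim landau_o.bigE)
  have "((\<lambda>x :: real^'n. norm x powr (2 - real CARD('n))) \<longlongrightarrow> 0) at_infinity"
    using card by (intro tendsto_neg_powr filterlim_norm_at_top) simp
  then have "((\<lambda>x :: real^'n. C * norm (norm x powr (2 - real CARD('n)))) \<longlongrightarrow> 0) at_infinity"
    by (intro tendsto_mult_right_zero tendsto_norm_zero)
  from Lim_null_comparison[OF C this]
  have "((\<lambda>x :: real^'n. ?d - d) \<longlongrightarrow> 0) at_infinity" .
  then show "d = ?d"
    using trivial_limit_at_infinity[where 'a = "real^'n"] by (simp add: tendsto_const_iff)
qed (simp only: radial_solution_asymptotics)

end

section \<open>From solutions to initial values\<close>

lemma solution_is_radial_solution: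
  assumes u: "u \<in> \<Phi> \<Gamma>"
    and eq: "\<forall>x \<in> - cball 0 1. f (eigvals (hessian u x)) = 1"
    and bdry: "\<forall>x \<in> sphere 0 1. u x = b"
  obtains \<alpha> where "\<alpha> \<ge> \<gamma>\<^sub>0" "u = radial_solution b \<alpha>"
proof -
  \<comment> \<open>Restricting to the ray through \<open>axis k 1\<close> lets \<open>w\<close> be
    read off from \<open>partial k u\<close>.\<close>
  define e :: "real^'n" where "e = axis k 1"
  have e: "norm e = 1"
    by (simp add: e_def)
  define \<phi> where "\<phi> r = u (r *\<^sub>R e)" for r
  have u_ext: "u \<in> extensional (- ball 0 1)"
    and u_rad: "\<And>x y. norm x \<ge> 1 \<Longrightarrow> norm x = norm y \<Longrightarrow> u x = u y"
    and u_C2: "Ck_on 2 u (- cball 0 1)"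
    and u_adm: "\<And>x. norm x > 1 \<Longrightarrow> eigvals (hessian u x) \<in> \<Gamma>"
    using u unfolding \<Phi>_def admissible_on_def mem_Collect_eq by (blast, blast, blast, simp)
  have u_\<phi>: "u x = \<phi> (norm x)" if "norm x \<ge> 1" for x
    unfolding \<phi>_def using that e by (intro u_rad) auto
  obtain Du where Du_cont: "continuous_on (- ball 0 1) Du"
    and Du: "\<And>x. x \<in> - ball 0 1 \<Longrightarrow> (u has_derivative (\<lambda>h. Du x \<bullet> h)) (at x within - ball 0 1)"
    using u unfolding \<Phi>_def C1_up_to_boundary_def mem_Collect_eq by blast
  \<comment> \<open>Defined through the gradient that is continuous up to the sphere, so that
    \<open>w\<close> has a value at 1, the future \<open>\<alpha>\<close>.\<close>
  define w where "w r = (Du (r *\<^sub>R e) \<bullet> e) / r" for r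
  have ray: "(\<lambda>r. r *\<^sub>R e) ` {1..} \<subseteq> - ball 0 1"
    using e by auto
  have w_cont: "continuous_on {1..} w"
    unfolding w_def by (intro continuous_intros continuous_on_compose2[OF Du_cont _ ray]) auto
  have \<phi>_within: "(\<phi> has_real_derivative r * w r) (at r within {1..})" if "r \<ge> 1" for r
  proof -
    have "((\<lambda>r. r *\<^sub>R e) has_derivative (\<lambda>h. h *\<^sub>R e)) (at r within {1..})"
      by (auto intro!: derivative_eq_intros)
    from has_derivative_in_compose2[OF Du ray _ this]
    have "(\<phi> has_derivative (\<lambda>h. Du (r *\<^sub>R e) \<bullet> (h *\<^sub>R e))) (at r within {1..})"
      using that by (simp add: \<phi>_def[abs_def])
    then show ?thesis
      by (rule has_derivative_imp_has_field_derivative) (use that in \<open>simp add: w_def\<close>)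
  qed
  have \<phi>_deriv: "(\<phi> has_real_derivative r * w r) (at r)" if "r > 1" for r
  proof -
    have "at r within {1..} = at r"
      using that by (intro at_within_interior) simp
    then show ?thesis
      using \<phi>_within[of r] that by simp
  qed
  \<comment> \<open>Away from the sphere \<open>w\<close> is an honest partial derivative divided by
    \<open>r\<close>, so second-order regularity of \<open>u\<close> makes it
    differentiable.\<close>
  have w_partial: "w r = partial k u (r *\<^sub>R e) / r" if "r > 1" for r
  proof -
    have re: "r *\<^sub>R e \<in> - cball 0 1" "r *\<^sub>R e \<in> - ball 0 1"
      using that e by simp_all
    have "(u has_derivative (\<lambda>h. Du (r *\<^sub>R e) \<bullet> h)) (at (r *\<^sub>R e) within - cball 0 1)"
      by (rule has_derivative_subset[OF Du[OF re(2)]]) auto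
    then have "(u has_derivative (\<lambda>h. Du (r *\<^sub>R e) \<bullet> h)) (at (r *\<^sub>R e))"
      by (simp only: at_within_open[OF re(1) open_exterior])
    from partial_eqI[OF this] show ?thesis
      by (simp add: w_def e_def)
  qed
  have "\<exists>D. (w has_real_derivative D) (at r)" if r: "r > 1" for r
  proof -
    have "partial k u differentiable (at (r *\<^sub>R e))"
      using u_C2 r e by (simp add: numeral_2_eq_2)
    then obtain P where "(partial k u has_derivative P) (at (r *\<^sub>R e))"
      by (auto simp: differentiable_def)
    moreover have "((\<lambda>r. r *\<^sub>R e) has_derivative (\<lambda>h. h *\<^sub>R e)) (at r)"
      by (auto intro!: derivative_eq_intros)
    ultimately have "((\<lambda>r. partial k u (r *\<^sub>R e)) has_derivative (\<lambda>h. P (h *\<^sub>R e))) (at r)"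
      by (rule has_derivative_compose[rotated])
    then have "(\<lambda>r. partial k u (r *\<^sub>R e)) differentiable (at r)"
      by (rule differentiableI)
    then have "(\<lambda>r. partial k u (r *\<^sub>R e) / r) differentiable (at r)"
      using r by (intro differentiable_divide differentiable_ident) auto
    then obtain D where "((\<lambda>r. partial k u (r *\<^sub>R e) / r) has_real_derivative D) (at r)"
      by (auto simp: real_differentiable_def)
    then have "(w has_real_derivative D) (at r)"
      using r by (rule_tac has_field_derivative_transform_within[where d = "r - 1"])
        (auto simp: w_partial dist_real_def)
    then show ?thesis
      by blast
  qed
  then obtain w' where w': "\<And>r. r > 1 \<Longrightarrow> (w has_real_derivative w' r) (at r)"
    by metis
  have level: "w r > \<gamma>\<^sub>0 \<and> w r + r * w' r = G (w r)" if "r > 1" for r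
  proof -
    have r: "norm (r *\<^sub>R e) = r" "norm (r *\<^sub>R e) > 1"
      using that e by auto
    obtain p where p: "p permutes UNIV"
      "eigvals (hessian u (r *\<^sub>R e)) =
        (\<chi> i. bvec k (w (norm (r *\<^sub>R e)) + norm (r *\<^sub>R e) * w' (norm (r *\<^sub>R e)))
          (w (norm (r *\<^sub>R e))) $ p i)"
      by (rule radial_eigvals[OF u_\<phi>[OF less_imp_le] \<phi>_deriv w' r(2)])
    have "f (eigvals (hessian u (r *\<^sub>R e))) = 1"
      using eq r(2) by simp
    then show ?thesis
      using admissible_iff[OF p(1)] u_adm[OF r(2)] unfolding p(2) r(1) by blast
  qed
  define \<alpha> where "\<alpha> = w 1"
  have w_sol: "W_solution G \<gamma>\<^sub>0 \<alpha> w"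
  proof (rule flow.W_solutionI[OF w_cont])
    show "(w has_real_derivative (G (w r) - w r) / r) (at r)" if "r > 1" for r
    proof -
      have "w' r = (G (w r) - w r) / r"
        using level[OF that] that by (simp add: field_simps)
      then show ?thesis
        using w'[OF that] by simp
    qed
  qed (use level in \<open>auto simp: \<alpha>_def\<close>)
  \<comment> \<open>The strict inequality outside the sphere survives only weakly in the limit;
    equality is the endpoint case of the theorem.\<close>
  have "\<alpha> \<ge> \<gamma>\<^sub>0"
  proof -
    have "(w \<longlongrightarrow> w 1) (at 1 within {1..})"
      using w_cont by (simp add: continuous_on_def)
    then have "(w \<longlongrightarrow> w 1) (at_right 1)"
      by (rule tendsto_within_subset) auto
    moreover have "\<forall>\<^sub>F r in at_right 1. \<gamma>\<^sub>0 \<le> w r"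
      using level by (auto simp: eventually_at_filter intro!: always_eventually less_imp_le)
    ultimately show ?thesis
      unfolding \<alpha>_def by (intro tendsto_lowerbound) auto
  qed
  moreover have "u = radial_solution b \<alpha>"
  proof
    fix x
    show "u x = radial_solution b \<alpha> x"
    proof (cases "norm x \<ge> 1")
      case True
      have "((\<lambda>s. s * w s) has_integral \<phi> (norm x) - \<phi> 1) {1..norm x}"
        using True has_field_derivative_subset[OF \<phi>_within]
        by (intro fundamental_theorem_of_calculus)
          (auto simp flip: has_real_derivative_iff_has_vector_derivative)
      moreover have "\<phi> 1 = b"
        using bdry e by (simp add: \<phi>_def)
      ultimately have "integral {1..norm x} (\<lambda>s. s * w s) = u x - b"
        using u_\<phi>[OF True] by (simp add: integral_unique)
      moreover have "integral {1..norm x} (\<lambda>s. s * w s) = integral {1..norm x} (\<lambda>s. s * W G \<gamma>\<^sub>0 s \<alpha>)"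
        using flow.W_solution_unique[OF w_sol \<open>\<alpha> \<ge> \<gamma>\<^sub>0\<close>] by (intro integral_cong) simp
      ultimately show ?thesis
        using radial_solution_eq[OF \<open>\<alpha> \<ge> \<gamma>\<^sub>0\<close> True] by simp
    next
      case False
      then show ?thesis
        using u_ext by (simp add: extensional_def radial_solution_def)
    qed
  qed
  ultimately show thesis
    using that by blast
qed

section \<open>Constants for which a solution exists\<close>

lemma unique_solution_iff:
  "(\<exists>!u. u \<in> \<Phi> \<Gamma> \<and>
      (\<forall>x \<in> - cball 0 1. f (eigvals (hessian u x)) = 1) \<and>
      (\<forall>x \<in> sphere 0 1. u x = b) \<and>
      (\<lambda>x. u x - (c / 2 * (norm x)\<^sup>2 + d)) \<in> O[at_infinity](\<lambda>x. norm x powr (2 - real CARD('n))))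
    \<longleftrightarrow> d \<in> {\<mu> G \<gamma>\<^sub>0 c \<gamma>\<^sub>0 + b - c / 2 ..}" (is "(\<exists>!u. ?P u) \<longleftrightarrow> _")
proof -
  have P: "?P u \<longleftrightarrow> (\<exists>\<alpha>\<ge>\<gamma>\<^sub>0. u = radial_solution b \<alpha> \<and> d = \<mu> G \<gamma>\<^sub>0 c \<alpha> + b - c / 2)" for u
  proof
    assume u: "?P u"
    obtain \<alpha> where \<alpha>: "\<alpha> \<ge> \<gamma>\<^sub>0" "u = radial_solution b \<alpha>"
      by (rule solution_is_radial_solution[of u b])
        (rule u[THEN conjunct1] u[THEN conjunct2, THEN conjunct1]
          u[THEN conjunct2, THEN conjunct2, THEN conjunct1])+
    have "d = \<mu> G \<gamma>\<^sub>0 c \<alpha> + b - c / 2"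
      using u[THEN conjunct2, THEN conjunct2, THEN conjunct2]
      unfolding \<alpha>(2) radial_solution_asymptotics_iff[OF \<alpha>(1)] .
    with \<alpha> show "\<exists>\<alpha>\<ge>\<gamma>\<^sub>0. u = radial_solution b \<alpha> \<and> d = \<mu> G \<gamma>\<^sub>0 c \<alpha> + b - c / 2"
      by (intro exI[of _ \<alpha>] conjI)
  next
    assume "\<exists>\<alpha>\<ge>\<gamma>\<^sub>0. u = radial_solution b \<alpha> \<and> d = \<mu> G \<gamma>\<^sub>0 c \<alpha> + b - c / 2"
    then obtain \<alpha> where \<alpha>: "\<alpha> \<ge> \<gamma>\<^sub>0" "u = radial_solution b \<alpha>" "d = \<mu> G \<gamma>\<^sub>0 c \<alpha> + b - c / 2"
      by blast
    show "?P u"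
      unfolding \<alpha>(2,3)
      using radial_solution_equation[OF \<alpha>(1)] radial_solution_sphere[OF \<alpha>(1)]
      by (intro conjI ballI radial_solution_\<Phi>[OF \<alpha>(1)] radial_solution_asymptotics[OF \<alpha>(1)])
  qed
  \<comment> \<open>Since \<open>d\<close> determines \<mu> at \<open>\<alpha>\<close>, injectivity
    leaves one candidate for \<open>\<alpha>\<close> and hence one function
    \<open>u\<close>.\<close>
  have inj: "\<alpha> = \<beta>" if "\<mu> G \<gamma>\<^sub>0 c \<alpha> = \<mu> G \<gamma>\<^sub>0 c \<beta>" "\<alpha> \<ge> \<gamma>\<^sub>0" "\<beta> \<ge> \<gamma>\<^sub>0" for \<alpha> \<beta>
    using flow.\<mu>_strict_mono[of \<alpha> \<beta>] flow.\<mu>_strict_mono[of \<beta> \<alpha>] that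
    by (cases \<alpha> \<beta> rule: linorder_cases) auto
  define Q where "Q u \<longleftrightarrow> (\<exists>\<alpha>\<ge>\<gamma>\<^sub>0. u = radial_solution b \<alpha> \<and> d = \<mu> G \<gamma>\<^sub>0 c \<alpha> + b - c / 2)" for u
  have "?P = Q"
    by (rule ext, unfold Q_def) (rule P)
  moreover have "(\<exists>!u. Q u) \<longleftrightarrow> d \<in> {\<mu> G \<gamma>\<^sub>0 c \<gamma>\<^sub>0 + b - c / 2 ..}"
  proof
    assume "\<exists>!u. Q u"
    then obtain u where "Q u"
      by (rule ex1E)
    then obtain \<alpha> where \<alpha>: "\<alpha> \<ge> \<gamma>\<^sub>0" "d = \<mu> G \<gamma>\<^sub>0 c \<alpha> + b - c / 2"
      \<comment> \<open>Existence alone bounds \<open>d\<close> from below, because \<mu> is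
        smallest at \<open>\<gamma>\<^sub>0\<close>.\<close>
      unfolding Q_def by (elim exE conjE)
    have "\<mu> G \<gamma>\<^sub>0 c \<gamma>\<^sub>0 \<le> \<mu> G \<gamma>\<^sub>0 c \<alpha>"
      using flow.\<mu>_strict_mono[of \<gamma>\<^sub>0 \<alpha>] \<alpha>(1) by (cases "\<alpha> = \<gamma>\<^sub>0") simp_all
    then show "d \<in> {\<mu> G \<gamma>\<^sub>0 c \<gamma>\<^sub>0 + b - c / 2 ..}"
      unfolding \<alpha>(2) by simp
  next
    assume "d \<in> {\<mu> G \<gamma>\<^sub>0 c \<gamma>\<^sub>0 + b - c / 2 ..}"
    then have "d - b + c / 2 \<ge> \<mu> G \<gamma>\<^sub>0 c \<gamma>\<^sub>0"
      by simp
    then obtain \<alpha> where \<alpha>: "\<alpha> \<ge> \<gamma>\<^sub>0" "\<mu> G \<gamma>\<^sub>0 c \<alpha> = d - b + c / 2"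
      by (rule flow.\<mu>_surj)
    show "\<exists>!u. Q u"
    proof (rule ex1I)
      show "Q (radial_solution b \<alpha>)"
        unfolding Q_def by (intro exI[of _ \<alpha>] conjI refl \<alpha>(1)) (use \<alpha>(2) in linarith)
      fix u assume "Q u"
      then obtain \<beta> where \<beta>: "\<beta> \<ge> \<gamma>\<^sub>0" "u = radial_solution b \<beta>" "d = \<mu> G \<gamma>\<^sub>0 c \<beta> + b - c / 2"
        unfolding Q_def by (elim exE conjE)
      have "\<mu> G \<gamma>\<^sub>0 c \<beta> = \<mu> G \<gamma>\<^sub>0 c \<alpha>"
        using \<alpha>(2) \<beta>(3) by linarith
      then have "\<beta> = \<alpha>"
        using \<beta>(1) \<alpha>(1) by (rule inj)
      then show "u = radial_solution b \<alpha>"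
        by (simp only: \<beta>(2))
    qed
  qed
  ultimately show ?thesis
    by (simp only:)
qed

end

text \<open>The index \<open>k\<close> that marks the first coordinate is arbitrary, by symmetry of
  \<Gamma> and \<open>f\<close>. The function \<open>f\<close> is total in the formalization, so
  \<open>vec c\<^sub>s\<close> is placed explicitly in \<open>closure \<Gamma>\<close>, the domain
  on which \<open>f\<close> is meaningful.\<close>

theorem theorem1p3:
  fixes f :: "real^'n::finite \<Rightarrow> real" and \<Gamma> :: "(real^'n) set" and k :: 'n
    and b c c\<^sub>s \<gamma>\<^sub>0 :: real
  assumes n: "CARD('n) \<ge> 3"
    and \<Gamma>_open: "open \<Gamma>"
    and \<Gamma>_convex: "convex \<Gamma>"
    and \<Gamma>_cone: "\<And>x t. x \<in> \<Gamma> \<Longrightarrow> t > 0 \<Longrightarrow> t *\<^sub>R x \<in> \<Gamma>"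
    and \<Gamma>_sym: "\<And>p x. p permutes UNIV \<Longrightarrow> x \<in> \<Gamma> \<Longrightarrow> (\<chi> i. x $ p i) \<in> \<Gamma>"
    and \<Gamma>_lower: "{x. \<forall>j. x $ j > 0} \<subseteq> \<Gamma>"
    and \<Gamma>_upper: "\<Gamma> \<subseteq> {x. (\<Sum>j\<in>UNIV. x $ j) > 0}"
    and f_smooth: "smooth_on f \<Gamma>"
    and f_cont: "continuous_on (closure \<Gamma>) f"
    and f_concave: "concave_on \<Gamma> f"
    and f_sym: "\<And>p x. p permutes UNIV \<Longrightarrow> x \<in> \<Gamma> \<Longrightarrow> f (\<chi> i. x $ p i) = f x"
    and f_pos: "\<And>x. x \<in> \<Gamma> \<Longrightarrow> f x > 0"
    and f_bdry: "\<And>x. x \<in> frontier \<Gamma> \<Longrightarrow> f x = 0"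
    and f_incr: "\<And>x j. x \<in> \<Gamma> \<Longrightarrow> partial j f x > 0"
    and c\<^sub>s: "vec c\<^sub>s \<in> closure \<Gamma>" "f (vec c\<^sub>s) = 1"
    and \<gamma>\<^sub>0: "0 \<le> \<gamma>\<^sub>0" "\<gamma>\<^sub>0 < c\<^sub>s"
      "{\<gamma>. \<exists>\<beta>. bvec k \<beta> \<gamma> \<in> \<Gamma> \<and> f (bvec k \<beta> \<gamma>) = 1} = {\<gamma>\<^sub>0<..}"
  shows "(\<exists>!u. u \<in> \<Phi> \<Gamma> \<and>
            (\<forall>x \<in> - cball 0 1. f (eigvals (hessian u x)) = 1) \<and>
            (\<forall>x \<in> sphere 0 1. u x = b) \<and>
            (\<lambda>x. u x - (c\<^sub>s / 2 * (norm x)\<^sup>2 + c))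
              \<in> O[at_infinity](\<lambda>x. norm x powr (2 - real CARD('n))))
         \<longleftrightarrow> c \<in> {\<mu> (g k f \<Gamma>) \<gamma>\<^sub>0 c\<^sub>s \<gamma>\<^sub>0 + b - c\<^sub>s / 2 ..}"
proof -
  have pos: "x \<in> \<Gamma>" if "\<And>j. x $ j > 0" for x
    using \<Gamma>_lower that by blast
  have C2: "Ck_on 2 f \<Gamma>"
    using f_smooth by (simp only: smooth_on_def)
  interpret hessian_operator f \<Gamma> k c\<^sub>s \<gamma>\<^sub>0
    by unfold_locales (fact assms pos C2)+
  show ?thesis
    by (rule unique_solution_iff)
qed

end
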